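(* Let $\nabla$ be an analytic connection on a manifold $\mathcal{M}$ of dimension $n$ and let $x\in \mathcal{M}$ be a fixed point. If $\dim \mathfrak{L}_k> (n^2-n)/2$ for some integer $k\ge 0$, then there is no pseudo-Riemannian metric $\mathsf{g}$ on $\mathcal{M}$ such that $\nabla$ is the Levi-Civita connection of $\mathsf{g}$.
   Context: A connection means a torsion-free affine connection $\nabla$ ($\nabla_XY-\nabla_YX=[X,Y]$). Its curvature tensor is $R(X,Y)Z=\nabla_X\nabla_YZ-\nabla_Y\nabla_XZ-\nabla_{[X,Y]}Z$, and $\nabla^jR$ denotes its $j$-th iterated covariant derivative. For $x\in\mathcal{M}$ and an integer $k\ge 0$, $\mathfrak{L}_k$ is the Lie subalgebra of $\mathrm{End}(\mathbb{T}_x\mathcal{M})$ generated by the linear maps $X_{v_1,\dots,v_{j+2}}:\mathbb{T}_x\mathcal{M}\to\mathbb{T}_x\mathcal{M}$, $X_{v_1,\dots,v_{j+2}}(u)=(\nabla^jR(v_1,v_2))(u,v_3,\dots,v_{j+2})$, where $v_1,\dots,v_{j+2}\in\mathbb{T}_x\mathcal{M}$ and $0\le j\le k$; here $v_1,v_2$ are the two arguments of the curvature operator, $u$ is the vector it acts on, and $v_3,\dots,v_{j+2}$ are the directions of covariant differentiation. *)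

theory Defs
  imports "HOL-Analysis.Analysis"
begin

section \<open>Smooth and real-analytic maps on open sets\<close>

fun Ck_on :: "nat \<Rightarrow> 'a::real_normed_vector set \<Rightarrow> ('a \<Rightarrow> 'b::real_normed_vector) \<Rightarrow> bool" where
  "Ck_on 0 S f \<longleftrightarrow> continuous_on S f"
| "Ck_on (Suc k) S f \<longleftrightarrow>
     (\<forall>z\<in>S. f differentiable (at z)) \<and> (\<forall>v. Ck_on k S (\<lambda>z. frechet_derivative f (at z) v))"

definition smooth_on :: "'a::real_normed_vector set \<Rightarrow> ('a \<Rightarrow> 'b::real_normed_vector) \<Rightarrow> bool" where
  "smooth_on S f \<longleftrightarrow> (\<forall>k. Ck_on k S f)"

text \<open>A map is real-analytic if it is smooth and near every point it is the sum of a convergent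
  power series in \<open>n\<close> variables; \<open>\<alpha>\<close> ranges over the multi-indices.\<close>

definition real_analytic_on ::
    "(real^'n) set \<Rightarrow> (real^'n \<Rightarrow> 'b::real_normed_vector) \<Rightarrow> bool" where
  "real_analytic_on S f \<longleftrightarrow> smooth_on S f \<and>
     (\<forall>z\<in>S. \<exists>r>0. \<exists>a::('n \<Rightarrow> nat) \<Rightarrow> 'b. \<forall>y\<in>ball z r.
        ((\<lambda>\<alpha>. (\<Prod>i\<in>UNIV. (y $ i - z $ i) ^ \<alpha> i) *\<^sub>R a \<alpha>) has_sum f y) UNIV)"


section \<open>Analytic manifolds\<close>

text \<open>A chart is a pair of its domain and its coordinate map. The manifold is the whole type
  \<open>'m\<close>, which carries the topology; its dimension is \<open>CARD('n)\<close>.\<close>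

type_synonym ('m, 'n) chart = "'m set \<times> ('m \<Rightarrow> real^'n)"

definition chart_image :: "('m, 'n::finite) chart \<Rightarrow> (real^'n) set" where
  "chart_image c = snd c ` fst c"

definition chart_inv :: "('m, 'n::finite) chart \<Rightarrow> real^'n \<Rightarrow> 'm" where
  "chart_inv c = inv_into (fst c) (snd c)"

definition analytic_atlas ::
    "('m::{t2_space, second_countable_topology}, 'n::finite) chart set \<Rightarrow> bool" where
  "analytic_atlas A \<longleftrightarrow>
     (\<Union>c\<in>A. fst c) = UNIV \<and>
     (\<forall>c\<in>A. open (fst c) \<and> open (chart_image c) \<and>
        homeomorphism (fst c) (chart_image c) (snd c) (chart_inv c)) \<and>
     (\<forall>c\<in>A. \<forall>d\<in>A. real_analytic_on (snd c ` (fst c \<inter> fst d)) (snd d \<circ> chart_inv c))"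

definition smooth_fun :: "('m, 'n::finite) chart set \<Rightarrow> ('m \<Rightarrow> real) \<Rightarrow> bool" where
  "smooth_fun A f \<longleftrightarrow> (\<forall>c\<in>A. smooth_on (chart_image c) (f \<circ> chart_inv c))"


section \<open>Tangent vectors and vector fields\<close>

text \<open>Each point \<open>p\<close> gets a preferred chart \<open>chart_at A p\<close>, and the tangent space at \<open>p\<close> is
  \<open>real^'n\<close> by means of the coordinates of that chart. As the preferred chart varies with \<open>p\<close>
  in an arbitrary way, a section of the tangent bundle is any map \<open>X :: 'm \<Rightarrow> real^'n\<close>, and its
  regularity is measured after passing to the coordinates of a fixed chart.\<close>

definition chart_at :: "('m, 'n::finite) chart set \<Rightarrow> 'm \<Rightarrow> ('m, 'n) chart" where
  "chart_at A p = (SOME c. c \<in> A \<and> p \<in> fst c)"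

text \<open>The differential at \<open>p\<close> of the transition from the chart \<open>c\<close> to the chart \<open>d\<close>.\<close>

definition transition_diff ::
    "('m, 'n::finite) chart \<Rightarrow> ('m, 'n) chart \<Rightarrow> 'm \<Rightarrow> real^'n \<Rightarrow> real^'n" where
  "transition_diff c d p = frechet_derivative (snd d \<circ> chart_inv c) (at (snd c p))"

type_synonym ('m, 'n) vfield = "'m \<Rightarrow> real^'n"

definition vf_coord ::
    "('m, 'n::finite) chart set \<Rightarrow> ('m, 'n) chart \<Rightarrow> ('m, 'n) vfield \<Rightarrow> real^'n \<Rightarrow> real^'n" where
  "vf_coord A c X z = (let p = chart_inv c z in transition_diff (chart_at A p) c p (X p))"

definition smooth_vf :: "('m, 'n::finite) chart set \<Rightarrow> ('m, 'n) vfield \<Rightarrow> bool" where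
  "smooth_vf A X \<longleftrightarrow> (\<forall>c\<in>A. smooth_on (chart_image c) (vf_coord A c X))"

definition dir_deriv ::
    "('m, 'n::finite) chart set \<Rightarrow> ('m, 'n) vfield \<Rightarrow> ('m \<Rightarrow> real) \<Rightarrow> 'm \<Rightarrow> real" where
  "dir_deriv A X f p =
     (let c = chart_at A p in frechet_derivative (f \<circ> chart_inv c) (at (snd c p)) (X p))"

definition lie_bracket ::
    "('m, 'n::finite) chart set \<Rightarrow> ('m, 'n) vfield \<Rightarrow> ('m, 'n) vfield \<Rightarrow> ('m, 'n) vfield" where
  "lie_bracket A X Y p =
     (let c = chart_at A p in
        frechet_derivative (vf_coord A c Y) (at (snd c p)) (X p)
        - frechet_derivative (vf_coord A c X) (at (snd c p)) (Y p))"


section \<open>Connections\<close>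

text \<open>A connection is an operator on smooth vector fields; its values on maps that are not smooth
  vector fields play no role.\<close>

definition affine_connection ::
    "('m, 'n::finite) chart set \<Rightarrow> (('m, 'n) vfield \<Rightarrow> ('m, 'n) vfield \<Rightarrow> ('m, 'n) vfield) \<Rightarrow> bool"
  where
  "affine_connection A nabla \<longleftrightarrow>
     (\<forall>X Y. smooth_vf A X \<longrightarrow> smooth_vf A Y \<longrightarrow> smooth_vf A (nabla X Y)) \<and>
     (\<forall>X X' Y. smooth_vf A X \<longrightarrow> smooth_vf A X' \<longrightarrow> smooth_vf A Y \<longrightarrow>
        nabla (\<lambda>p. X p + X' p) Y = (\<lambda>p. nabla X Y p + nabla X' Y p)) \<and>
     (\<forall>f X Y. smooth_fun A f \<longrightarrow> smooth_vf A X \<longrightarrow> smooth_vf A Y \<longrightarrow>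
        nabla (\<lambda>p. f p *\<^sub>R X p) Y = (\<lambda>p. f p *\<^sub>R nabla X Y p)) \<and>
     (\<forall>X Y Y'. smooth_vf A X \<longrightarrow> smooth_vf A Y \<longrightarrow> smooth_vf A Y' \<longrightarrow>
        nabla X (\<lambda>p. Y p + Y' p) = (\<lambda>p. nabla X Y p + nabla X Y' p)) \<and>
     (\<forall>f X Y. smooth_fun A f \<longrightarrow> smooth_vf A X \<longrightarrow> smooth_vf A Y \<longrightarrow>
        nabla X (\<lambda>p. f p *\<^sub>R Y p) = (\<lambda>p. dir_deriv A X f p *\<^sub>R Y p + f p *\<^sub>R nabla X Y p))"

definition torsion_free ::
    "('m, 'n::finite) chart set \<Rightarrow> (('m, 'n) vfield \<Rightarrow> ('m, 'n) vfield \<Rightarrow> ('m, 'n) vfield) \<Rightarrow> bool"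
  where
  "torsion_free A nabla \<longleftrightarrow>
     (\<forall>X Y. smooth_vf A X \<longrightarrow> smooth_vf A Y \<longrightarrow>
        (\<lambda>p. nabla X Y p - nabla Y X p) = lie_bracket A X Y)"

text \<open>A connection is analytic if its Christoffel symbols \<open>\<Gamma>\<close> in every chart of the analytic atlas
  are analytic functions of the coordinates.\<close>

definition analytic_connection ::
    "('m, 'n::finite) chart set \<Rightarrow> (('m, 'n) vfield \<Rightarrow> ('m, 'n) vfield \<Rightarrow> ('m, 'n) vfield) \<Rightarrow> bool"
  where
  "analytic_connection A nabla \<longleftrightarrow>
     affine_connection A nabla \<and> torsion_free A nabla \<and>
     (\<forall>c\<in>A. \<exists>\<Gamma> :: real^'n \<Rightarrow> real^'n \<Rightarrow> real^'n \<Rightarrow> real^'n.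
        (\<forall>z\<in>chart_image c. bilinear (\<Gamma> z)) \<and>
        (\<forall>v w. real_analytic_on (chart_image c) (\<lambda>z. \<Gamma> z v w)) \<and>
        (\<forall>X Y. smooth_vf A X \<longrightarrow> smooth_vf A Y \<longrightarrow>
          (\<forall>z\<in>chart_image c. vf_coord A c (nabla X Y) z =
             frechet_derivative (vf_coord A c Y) (at z) (vf_coord A c X z)
             + \<Gamma> z (vf_coord A c X z) (vf_coord A c Y z))))"


section \<open>Curvature and its iterated covariant derivatives\<close>

text \<open>Vector-valued tensor fields are functions of the list of their vector field arguments. In
  \<open>nabla_curvature A nabla j\<close> the list has \<open>j + 3\<close> entries: the two arguments of the curvature
  operator, the field it acts on, and then the directions of differentiation, the most recent
  one last.\<close>

definition curvature ::
    "('m, 'n::finite) chart set \<Rightarrow> (('m, 'n) vfield \<Rightarrow> ('m, 'n) vfield \<Rightarrow> ('m, 'n) vfield)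
     \<Rightarrow> ('m, 'n) vfield \<Rightarrow> ('m, 'n) vfield \<Rightarrow> ('m, 'n) vfield \<Rightarrow> ('m, 'n) vfield" where
  "curvature A nabla X Y Z = (\<lambda>p. nabla X (nabla Y Z) p - nabla Y (nabla X Z) p
     - nabla (lie_bracket A X Y) Z p)"

definition covariant_deriv ::
    "(('m, 'n::finite) vfield \<Rightarrow> ('m, 'n) vfield \<Rightarrow> ('m, 'n) vfield)
     \<Rightarrow> (('m, 'n) vfield list \<Rightarrow> ('m, 'n) vfield) \<Rightarrow> ('m, 'n) vfield list \<Rightarrow> ('m, 'n) vfield" where
  "covariant_deriv nabla T Vs =
     (let W = last Vs; Us = butlast Vs in
      (\<lambda>p. nabla W (T Us) p - (\<Sum>i<length Us. T (Us[i := nabla W (Us ! i)]) p)))"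

definition nabla_curvature ::
    "('m, 'n::finite) chart set \<Rightarrow> (('m, 'n) vfield \<Rightarrow> ('m, 'n) vfield \<Rightarrow> ('m, 'n) vfield)
     \<Rightarrow> nat \<Rightarrow> ('m, 'n) vfield list \<Rightarrow> ('m, 'n) vfield" where
  "nabla_curvature A nabla j =
     (covariant_deriv nabla ^^ j) (\<lambda>Vs. curvature A nabla (Vs ! 0) (Vs ! 1) (Vs ! 2))"

text \<open>To evaluate a tensor field on vectors at \<open>x\<close>, these are extended to smooth vector fields;
  by tensoriality the value does not depend on the extensions.\<close>

definition extend_vf :: "('m, 'n::finite) chart set \<Rightarrow> 'm \<Rightarrow> real^'n \<Rightarrow> ('m, 'n) vfield" where
  "extend_vf A x v = (SOME X. smooth_vf A X \<and> X x = v)"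

definition curv_endo ::
    "('m, 'n::finite) chart set \<Rightarrow> (('m, 'n) vfield \<Rightarrow> ('m, 'n) vfield \<Rightarrow> ('m, 'n) vfield)
     \<Rightarrow> 'm \<Rightarrow> real^'n \<Rightarrow> real^'n \<Rightarrow> (real^'n) list \<Rightarrow> real^'n \<Rightarrow> real^'n" where
  "curv_endo A nabla x v1 v2 vs u =
     nabla_curvature A nabla (length vs) (map (extend_vf A x) (v1 # v2 # u # vs)) x"


section \<open>The Lie algebras generated by the curvature\<close>

text \<open>Endomorphisms of the tangent space at \<open>x\<close> are represented by their matrices.\<close>

definition lie_subalgebra :: "(real^'n^'n) set \<Rightarrow> bool" where
  "lie_subalgebra L \<longleftrightarrow> subspace L \<and> (\<forall>P\<in>L. \<forall>Q\<in>L. P ** Q - Q ** P \<in> L)"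

definition curv_lie_algebra ::
    "('m, 'n::finite) chart set \<Rightarrow> (('m, 'n) vfield \<Rightarrow> ('m, 'n) vfield \<Rightarrow> ('m, 'n) vfield)
     \<Rightarrow> 'm \<Rightarrow> nat \<Rightarrow> (real^'n^'n) set" where
  "curv_lie_algebra A nabla x k =
     lie_subalgebra hull {matrix (curv_endo A nabla x v1 v2 vs) | v1 v2 vs. length vs \<le> k}"


section \<open>Pseudo-Riemannian metrics\<close>

definition pseudo_riemannian_metric ::
    "('m, 'n::finite) chart set \<Rightarrow> ('m \<Rightarrow> real^'n \<Rightarrow> real^'n \<Rightarrow> real) \<Rightarrow> bool" where
  "pseudo_riemannian_metric A g \<longleftrightarrow>
     (\<forall>p. bilinear (g p) \<and> (\<forall>v w. g p v w = g p w v) \<and>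
          (\<forall>v. (\<forall>w. g p v w = 0) \<longrightarrow> v = 0)) \<and>
     (\<forall>c\<in>A. \<forall>v w. smooth_on (chart_image c)
        (\<lambda>z. let p = chart_inv c z; T = transition_diff c (chart_at A p) p in g p (T v) (T w)))"

definition levi_civita ::
    "('m, 'n::finite) chart set \<Rightarrow> ('m \<Rightarrow> real^'n \<Rightarrow> real^'n \<Rightarrow> real)
     \<Rightarrow> (('m, 'n) vfield \<Rightarrow> ('m, 'n) vfield \<Rightarrow> ('m, 'n) vfield) \<Rightarrow> bool" where
  "levi_civita A g nabla \<longleftrightarrow>
     affine_connection A nabla \<and> torsion_free A nabla \<and>
     (\<forall>X Y Z. smooth_vf A X \<longrightarrow> smooth_vf A Y \<longrightarrow> smooth_vf A Z \<longrightarrow>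
        dir_deriv A X (\<lambda>p. g p (Y p) (Z p)) =
          (\<lambda>p. g p (nabla X Y p) (Z p) + g p (Y p) (nabla X Z p)))"

end

theory Submission
  imports Defs
begin

text \<open>If \<open>\<nabla>\<close> is the Levi-Civita connection of \<open>g\<close>, then \<open>R(X, Y)\<close> is skew with respect to \<open>g\<close>:
  differentiating \<open>g(U, W)\<close> along \<open>X\<close> and \<open>Y\<close> in both orders, and along \<open>[X, Y]\<close>, all terms but
  \<open>g(R(X, Y)U, W) + g(U, R(X, Y)W)\<close> cancel. Differentiating this identity covariantly shows the same
  for every \<open>\<nabla>\<^sup>jR\<close>. So all the generators of the Lie algebra lie in the Lie algebra
  \<open>\<ss>\<oo>(g\<^sub>x)\<close>, whose dimension is \<open>n(n - 1)/2\<close>.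

  Skewness is proved for vector fields. It passes to the endomorphisms at \<open>x\<close> without tensoriality,
  because only the value at \<open>x\<close> of the extension of a vector enters; that an extension exists needs
  bump functions.\<close>


section \<open>Calculus of smooth maps\<close>

lemma Ck_on_differentiable: "Ck_on (Suc k) S f \<Longrightarrow> z \<in> S \<Longrightarrow> f differentiable (at z)"
  by simp

lemma Ck_on_has_derivative:
  "Ck_on (Suc k) S f \<Longrightarrow> z \<in> S \<Longrightarrow> (f has_derivative frechet_derivative f (at z)) (at z)"
  by (simp add: frechet_derivative_works)

text \<open>On an open set the derivative at a point depends only on values near it, so equality
  passes from \<open>f\<close> and \<open>g\<close> to their directional derivatives and the
  induction can proceed. The later use is to replace \<open>frechet_derivative\<close> by an
  explicit formula known only on \<open>S\<close>.\<close>

lemma Ck_on_cong: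
  assumes "open S" and "\<And>z. z \<in> S \<Longrightarrow> f z = g z"
  shows "Ck_on k S f \<longleftrightarrow> Ck_on k S g"
  using assms(2)
proof (induction k arbitrary: f g)
  case 0
  then show ?case by (auto cong: continuous_on_cong)
next
  case (Suc k)
  have D: "frechet_derivative f (at z) = frechet_derivative g (at z) \<and> g differentiable (at z)"
    if "f differentiable (at z)" "z \<in> S" "\<And>z. z \<in> S \<Longrightarrow> f z = g z"
    for f g :: "'a \<Rightarrow> 'b" and z
    by (metis that assms(1) frechet_derivative_transform_within_open differentiable_def
        has_derivative_transform_within_open)
  have imp: "Ck_on (Suc k) S g" if "Ck_on (Suc k) S f" "\<And>z. z \<in> S \<Longrightarrow> f z = g z"
    for f g :: "'a \<Rightarrow> 'b"
  proof -
    have d: "f differentiable (at z)" if "z \<in> S" for z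
      using \<open>Ck_on (Suc k) S f\<close> that by simp
    have "Ck_on k S (\<lambda>z. frechet_derivative f (at z) v)" for v
      using \<open>Ck_on (Suc k) S f\<close> by simp
    moreover have "frechet_derivative f (at z) v = frechet_derivative g (at z) v" if "z \<in> S" for v z
      using D[OF d[OF that] that, of g] \<open>\<And>z. z \<in> S \<Longrightarrow> f z = g z\<close> by metis
    ultimately have "Ck_on k S (\<lambda>z. frechet_derivative g (at z) v)" for v
      using Suc.IH[of "\<lambda>z. frechet_derivative f (at z) v" "\<lambda>z. frechet_derivative g (at z) v"]
      by blast
    moreover have "g differentiable (at z)" if "z \<in> S" for z
      using D[OF d[OF that] that, of g] \<open>\<And>z. z \<in> S \<Longrightarrow> f z = g z\<close> by metis
    ultimately show ?thesis by simp
  qed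
  show ?case using imp[of f g] imp[of g f] Suc.prems by metis
qed

lemma Ck_on_Suc_D: "Ck_on (Suc k) S f \<Longrightarrow> Ck_on k S f"
proof (induction k arbitrary: f)
  case 0
  then show ?case
    by (auto intro!: continuous_at_imp_continuous_on differentiable_imp_continuous_within)
next
  case (Suc k)
  then show ?case by (metis Ck_on.simps(2))
qed

lemma Ck_on_locally:
  assumes "\<And>z. z \<in> S \<Longrightarrow> \<exists>U. open U \<and> z \<in> U \<and> Ck_on k U f"
  shows "Ck_on k S f"
  using assms
proof (induction k arbitrary: f)
  case 0
  then show ?case
    by (meson Ck_on.simps(1) continuous_at_imp_continuous_on continuous_on_eq_continuous_at)
next
  case (Suc k)
  then show ?case by (metis Ck_on.simps(2))
qed

lemma Ck_on_const: "Ck_on k S (\<lambda>_. c)"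
  by (induction k arbitrary: c) auto

text \<open>The induction here is the model for sums, products and compositions: exhibit the
  derivative \<open>D\<close> of the compound map, show by induction that the formula is
  \<open>k\<close> times differentiable, and transfer this to \<open>frechet_derivative\<close> by
  \<open>Ck_on_cong\<close>.\<close>

lemma Ck_on_bounded_linear_compose:
  assumes "bounded_linear L" and "open S" and "Ck_on k S f"
  shows "Ck_on k S (\<lambda>z. L (f z))"
  using assms(3)
proof (induction k arbitrary: f)
  case 0
  then show ?case
    using assms(1) by (auto intro: bounded_linear.continuous_on)
next
  case (Suc k)
  have D: "((\<lambda>z. L (f z)) has_derivative (\<lambda>v. L (frechet_derivative f (at z) v))) (at z)"
    if "z \<in> S" for z
    using bounded_linear.has_derivative[OF assms(1) Ck_on_has_derivative[OF Suc.prems that]] .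
  have "Ck_on k S (\<lambda>z. frechet_derivative (\<lambda>z. L (f z)) (at z) v)" for v
  proof -
    have "Ck_on k S (\<lambda>z. L (frechet_derivative f (at z) v))"
      using Suc by auto
    then show ?thesis
      by (subst Ck_on_cong[OF assms(2)]) (auto simp: frechet_derivative_at[OF D, symmetric])
  qed
  then show ?case using D by (auto simp: differentiable_def)
qed

lemma Ck_on_id: "Ck_on k S (\<lambda>z. z)"
  by (cases k) (auto simp: Ck_on_const)

lemma Ck_on_add:
  assumes "open S" and "Ck_on k S f" and "Ck_on k S g"
  shows "Ck_on k S (\<lambda>z. f z + g z)"
  using assms(2,3)
proof (induction k arbitrary: f g)
  case 0
  then show ?case by (auto intro: continuous_on_add)
next
  case (Suc k)
  have D: "((\<lambda>z. f z + g z) has_derivative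
      (\<lambda>v. frechet_derivative f (at z) v + frechet_derivative g (at z) v)) (at z)"
    if "z \<in> S" for z
    using Ck_on_has_derivative[OF Suc.prems(1) that] Ck_on_has_derivative[OF Suc.prems(2) that]
    by (rule has_derivative_add)
  have "Ck_on k S (\<lambda>z. frechet_derivative (\<lambda>z. f z + g z) (at z) v)" for v
  proof -
    have "Ck_on k S (\<lambda>z. frechet_derivative f (at z) v + frechet_derivative g (at z) v)"
      using Suc by auto
    then show ?thesis
      by (subst Ck_on_cong[OF assms(1)]) (auto simp: frechet_derivative_at[OF D, symmetric])
  qed
  then show ?case using D by (auto simp: differentiable_def)
qed

lemma Ck_on_sum:
  assumes "open S" and "\<And>i. i \<in> I \<Longrightarrow> Ck_on k S (f i)"
  shows "Ck_on k S (\<lambda>z. \<Sum>i\<in>I. f i z)"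
  using assms(2) by (induction I rule: infinite_finite_induct) (auto simp: Ck_on_const Ck_on_add assms(1))

text \<open>Each term of the product rule pairs a derivative, of order \<open>k\<close>, with an
  undifferentiated factor, of order \<open>Suc k\<close>; \<open>Ck_on_Suc_D\<close> lowers the
  latter so that the induction hypothesis fits both.\<close>

lemma Ck_on_bounded_bilinear:
  assumes "bounded_bilinear B" and "open S" and "Ck_on k S f" and "Ck_on k S g"
  shows "Ck_on k S (\<lambda>z. B (f z) (g z))"
  using assms(3,4)
proof (induction k arbitrary: f g)
  case 0
  then show ?case using assms(1) by (auto intro: bounded_bilinear.continuous_on)
next
  case (Suc k)
  have D: "((\<lambda>z. B (f z) (g z)) has_derivative
      (\<lambda>v. B (f z) (frechet_derivative g (at z) v) + B (frechet_derivative f (at z) v) (g z))) (at z)"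
    if "z \<in> S" for z
    using bounded_bilinear.FDERIV[OF assms(1) Ck_on_has_derivative[OF Suc.prems(1) that]
      Ck_on_has_derivative[OF Suc.prems(2) that]] .
  have "Ck_on k S (\<lambda>z. frechet_derivative (\<lambda>z. B (f z) (g z)) (at z) v)" for v
  proof -
    have "Ck_on k S (\<lambda>z. B (f z) (frechet_derivative g (at z) v)
        + B (frechet_derivative f (at z) v) (g z))"
      using Suc.prems by (intro Ck_on_add assms(2) Suc.IH) (auto intro: Ck_on_Suc_D[where S=S])
    then show ?thesis
      by (subst Ck_on_cong[OF assms(2)]) (auto simp: frechet_derivative_at[OF D, symmetric])
  qed
  then show ?case using D by (auto simp: differentiable_def)
qed

lemmas Ck_on_scaleR = Ck_on_bounded_bilinear[OF bounded_bilinear_scaleR]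
lemmas Ck_on_mult = Ck_on_bounded_bilinear[OF bounded_bilinear_mult]

lemma linear_euclidean_expand:
  fixes L :: "'a::euclidean_space \<Rightarrow> 'b::real_vector"
  assumes "linear L"
  shows "L v = (\<Sum>b\<in>Basis. (v \<bullet> b) *\<^sub>R L b)"
  by (metis (no_types, lifting) assms euclidean_representation linear_scale linear_sum sum.cong)

text \<open>In the chain rule the direction fed to the derivative of \<open>f\<close> varies with
  \<open>z\<close>, whereas \<open>Ck_on\<close> speaks of fixed directions. Expanding that
  direction in a basis of the middle space gives a finite sum of products of maps covered by the
  induction hypothesis.\<close>

lemma Ck_on_compose:
  fixes g :: "'a::real_normed_vector \<Rightarrow> 'b::euclidean_space" and f :: "'b \<Rightarrow> 'c::real_normed_vector"
  assumes "open S" and "Ck_on k T f" and "Ck_on k S g" and "g ` S \<subseteq> T"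
  shows "Ck_on k S (\<lambda>z. f (g z))"
  using assms(2,3)
proof (induction k arbitrary: f)
  case 0
  then show ?case using assms(4) by (auto intro: continuous_on_compose2)
next
  case (Suc k)
  have gT: "g z \<in> T" if "z \<in> S" for z using that assms(4) by auto
  have D: "((\<lambda>z. f (g z)) has_derivative
      (\<lambda>v. \<Sum>b\<in>Basis. (frechet_derivative g (at z) v \<bullet> b) *\<^sub>R frechet_derivative f (at (g z)) b)) (at z)"
    if "z \<in> S" for z
  proof -
    have f: "(f has_derivative frechet_derivative f (at (g z))) (at (g z))"
      using Ck_on_has_derivative[OF Suc.prems(1) gT[OF that]] .
    have "((\<lambda>z. f (g z)) has_derivative
      (\<lambda>v. frechet_derivative f (at (g z)) (frechet_derivative g (at z) v))) (at z)"
      using diff_chain_at[OF Ck_on_has_derivative[OF Suc.prems(2) that] f] by (simp add: o_def)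
    then show ?thesis
      by (subst (asm) linear_euclidean_expand[OF has_derivative_linear[OF f]])
  qed
  have "Ck_on k S (\<lambda>z. frechet_derivative (\<lambda>z. f (g z)) (at z) v)" for v
  proof -
    have "Ck_on k S (\<lambda>z. \<Sum>b\<in>Basis. (frechet_derivative g (at z) v \<bullet> b) *\<^sub>R
        frechet_derivative f (at (g z)) b)"
    proof (intro Ck_on_sum Ck_on_scaleR assms(1))
      fix b :: 'b
      show "Ck_on k S (\<lambda>z. frechet_derivative g (at z) v \<bullet> b)"
        using Suc.prems(2)
        by (intro Ck_on_bounded_linear_compose[OF bounded_linear_inner_left assms(1)]) auto
      show "Ck_on k S (\<lambda>z. frechet_derivative f (at (g z)) b)"
        using Suc.prems by (intro Suc.IH[of "\<lambda>y. frechet_derivative f (at y) b"])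
          (auto intro: Ck_on_Suc_D[where S=S])
    qed
    then show ?thesis
      by (subst Ck_on_cong[OF assms(1)]) (auto simp: frechet_derivative_at[OF D, symmetric])
  qed
  then show ?case using D by (auto simp: differentiable_def)
qed

section \<open>The same closure properties for smooth maps\<close>

lemma smooth_on_Ck: "smooth_on S f \<Longrightarrow> Ck_on k S f"
  by (simp add: smooth_on_def)

lemma smooth_on_differentiable: "smooth_on S f \<Longrightarrow> z \<in> S \<Longrightarrow> f differentiable (at z)"
  using Ck_on_differentiable smooth_on_Ck by blast

lemma smooth_on_frechet_derivative:
  "smooth_on S f \<Longrightarrow> smooth_on S (\<lambda>z. frechet_derivative f (at z) v)"
  unfolding smooth_on_def by (metis Ck_on.simps(2))

lemma smooth_on_congI:
  assumes "open S" and "\<And>z. z \<in> S \<Longrightarrow> f z = g z" and "smooth_on S g"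
  shows "smooth_on S f"
  using assms Ck_on_cong[OF assms(1,2)] by (simp add: smooth_on_def)

lemma smooth_on_locally:
  "(\<And>z. z \<in> S \<Longrightarrow> \<exists>U. open U \<and> z \<in> U \<and> smooth_on U f) \<Longrightarrow> smooth_on S f"
  unfolding smooth_on_def by (meson Ck_on_locally)

lemma smooth_on_const: "smooth_on S (\<lambda>_. c)"
  by (simp add: smooth_on_def Ck_on_const)

lemma smooth_on_id: "smooth_on S (\<lambda>z. z)"
  by (simp add: smooth_on_def Ck_on_id)

lemma smooth_on_add:
  "open S \<Longrightarrow> smooth_on S f \<Longrightarrow> smooth_on S g \<Longrightarrow> smooth_on S (\<lambda>z. f z + g z)"
  by (simp add: smooth_on_def Ck_on_add)

lemma smooth_on_bounded_linear_compose:
  "bounded_linear L \<Longrightarrow> open S \<Longrightarrow> smooth_on S f \<Longrightarrow> smooth_on S (\<lambda>z. L (f z))"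
  by (simp add: smooth_on_def Ck_on_bounded_linear_compose)

lemma smooth_on_minus:
  "open S \<Longrightarrow> smooth_on S f \<Longrightarrow> smooth_on S (\<lambda>z. - f z)"
  by (rule smooth_on_bounded_linear_compose[OF bounded_linear_minus[OF bounded_linear_ident]])

lemma smooth_on_sum:
  "open S \<Longrightarrow> (\<And>i. i \<in> I \<Longrightarrow> smooth_on S (f i)) \<Longrightarrow> smooth_on S (\<lambda>z. \<Sum>i\<in>I. f i z)"
  by (simp add: smooth_on_def Ck_on_sum)

lemma smooth_on_bounded_bilinear:
  "bounded_bilinear B \<Longrightarrow> open S \<Longrightarrow> smooth_on S f \<Longrightarrow> smooth_on S g \<Longrightarrow>
    smooth_on S (\<lambda>z. B (f z) (g z))"
  by (simp add: smooth_on_def Ck_on_bounded_bilinear)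

lemmas smooth_on_scaleR = smooth_on_bounded_bilinear[OF bounded_bilinear_scaleR]
lemmas smooth_on_mult = smooth_on_bounded_bilinear[OF bounded_bilinear_mult]
lemmas smooth_on_inner = smooth_on_bounded_bilinear[OF bounded_bilinear_inner]

lemma smooth_on_compose:
  fixes g :: "'a::real_normed_vector \<Rightarrow> 'b::euclidean_space" and f :: "'b \<Rightarrow> 'c::real_normed_vector"
  shows "open S \<Longrightarrow> smooth_on T f \<Longrightarrow> smooth_on S g \<Longrightarrow> g ` S \<subseteq> T \<Longrightarrow>
    smooth_on S (\<lambda>z. f (g z))"
  unfolding smooth_on_def using Ck_on_compose by blast


section \<open>Symmetry of second derivatives\<close>

text \<open>The mean value theorem is applied twice: first along \<open>v\<close> to the difference
  of the values at points that are \<open>h *\<^sub>R w\<close> apart, then along \<open>w\<close>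
  to the resulting first derivative.\<close>

lemma second_difference_mean_value:
  fixes f :: "'a::real_normed_vector \<Rightarrow> real"
  assumes f: "Ck_on (Suc (Suc 0)) S f" and "h > 0"
    and S: "\<And>s t. 0 \<le> s \<Longrightarrow> s \<le> h \<Longrightarrow> 0 \<le> t \<Longrightarrow> t \<le> h \<Longrightarrow> z + s *\<^sub>R v + t *\<^sub>R w \<in> S"
  shows "\<exists>s t. 0 \<le> s \<and> s \<le> h \<and> 0 \<le> t \<and> t \<le> h \<and>
    f (z + h *\<^sub>R v + h *\<^sub>R w) - f (z + h *\<^sub>R v) - (f (z + h *\<^sub>R w) - f z) =
      h * h * frechet_derivative (\<lambda>y. frechet_derivative f (at y) v) (at (z + s *\<^sub>R v + t *\<^sub>R w)) w"
proof -
  let ?D = "\<lambda>y. frechet_derivative f (at y)"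
  have D: "(f has_derivative ?D y) (at y)" if "y \<in> S" for y
    using Ck_on_has_derivative[OF f that] .
  have D2: "((\<lambda>y. ?D y v) has_derivative frechet_derivative (\<lambda>y. ?D y v) (at y)) (at y)"
    if "y \<in> S" for y
    using f that by (intro Ck_on_has_derivative[of 0 S]) auto
  have mem: "z + s *\<^sub>R v \<in> S" if "0 \<le> s" "s \<le> h" for s
    using S[OF that, of 0] \<open>h > 0\<close> by auto
  have mem': "z + s *\<^sub>R v + h *\<^sub>R w \<in> S" if "0 \<le> s" "s \<le> h" for s
    using S[OF that, of h] \<open>h > 0\<close> by auto
  \<comment> \<open>The terms with factor \<open>0\<close> and the increment \<open>h - 0\<close>
    keep the shape of the mean value theorem on \<open>{0..h}\<close>.\<close>
  have "\<exists>s\<in>{0..h}. (f (z + h *\<^sub>R v + h *\<^sub>R w) - f (z + h *\<^sub>R v))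
      - (f (z + 0 *\<^sub>R v + h *\<^sub>R w) - f (z + 0 *\<^sub>R v))
      = (\<lambda>d. ?D (z + s *\<^sub>R v + h *\<^sub>R w) (d *\<^sub>R v) - ?D (z + s *\<^sub>R v) (d *\<^sub>R v)) (h - 0)"
  proof (rule mvt_very_simple)
    fix s assume s: "0 \<le> s" "s \<le> h"
    have "((\<lambda>s. f (z + s *\<^sub>R v + h *\<^sub>R w)) has_derivative
        (\<lambda>d. ?D (z + s *\<^sub>R v + h *\<^sub>R w) (d *\<^sub>R v))) (at s within {0..h})"
      by (rule has_derivative_compose[where f="\<lambda>s. z + s *\<^sub>R v + h *\<^sub>R w" and g=f,
          OF _ D[OF mem'[OF s]]])
        (auto intro!: derivative_eq_intros)
    moreover have "((\<lambda>s. f (z + s *\<^sub>R v)) has_derivative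
        (\<lambda>d. ?D (z + s *\<^sub>R v) (d *\<^sub>R v))) (at s within {0..h})"
      by (rule has_derivative_compose[where f="\<lambda>s. z + s *\<^sub>R v" and g=f,
          OF _ D[OF mem[OF s]]])
        (auto intro!: derivative_eq_intros)
    ultimately show "((\<lambda>s. f (z + s *\<^sub>R v + h *\<^sub>R w) - f (z + s *\<^sub>R v)) has_derivative
      (\<lambda>d. ?D (z + s *\<^sub>R v + h *\<^sub>R w) (d *\<^sub>R v) - ?D (z + s *\<^sub>R v) (d *\<^sub>R v))) (at s within {0..h})"
      by (rule has_derivative_diff)
  qed (use \<open>h > 0\<close> in auto)
  then obtain s where s: "0 \<le> s" "s \<le> h" and s_eq:
    "f (z + h *\<^sub>R v + h *\<^sub>R w) - f (z + h *\<^sub>R v) - (f (z + h *\<^sub>R w) - f z)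
      = ?D (z + s *\<^sub>R v + h *\<^sub>R w) (h *\<^sub>R v) - ?D (z + s *\<^sub>R v) (h *\<^sub>R v)"
    by auto
  have "\<exists>t\<in>{0..h}. ?D (z + s *\<^sub>R v + h *\<^sub>R w) v - ?D (z + s *\<^sub>R v + 0 *\<^sub>R w) v
      = (\<lambda>d. frechet_derivative (\<lambda>y. ?D y v) (at (z + s *\<^sub>R v + t *\<^sub>R w)) (d *\<^sub>R w)) (h - 0)"
  proof (rule mvt_very_simple)
    fix t assume t: "0 \<le> t" "t \<le> h"
    show "((\<lambda>t. ?D (z + s *\<^sub>R v + t *\<^sub>R w) v) has_derivative
        (\<lambda>d. frechet_derivative (\<lambda>y. ?D y v) (at (z + s *\<^sub>R v + t *\<^sub>R w)) (d *\<^sub>R w))) (at t within {0..h})"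
      by (rule has_derivative_compose[where f="\<lambda>t. z + s *\<^sub>R v + t *\<^sub>R w" and g="\<lambda>y. ?D y v",
          OF _ D2[OF S[OF s t]]])
        (auto intro!: derivative_eq_intros)
  qed (use \<open>h > 0\<close> in auto)
  then obtain t where t: "0 \<le> t" "t \<le> h" and t_eq:
    "?D (z + s *\<^sub>R v + h *\<^sub>R w) v - ?D (z + s *\<^sub>R v) v
      = frechet_derivative (\<lambda>y. ?D y v) (at (z + s *\<^sub>R v + t *\<^sub>R w)) (h *\<^sub>R w)"
    by auto
  have "?D y (h *\<^sub>R v) = h * ?D y v" if "y \<in> S" for y
    using linear_scale[OF has_derivative_linear[OF D[OF that]]] by simp
  moreover have "frechet_derivative (\<lambda>y. ?D y v) (at y) (h *\<^sub>R w)
      = h * frechet_derivative (\<lambda>y. ?D y v) (at y) w" if "y \<in> S" for y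
    using linear_scale[OF has_derivative_linear[OF D2[OF that]]] by simp
  ultimately have "f (z + h *\<^sub>R v + h *\<^sub>R w) - f (z + h *\<^sub>R v) - (f (z + h *\<^sub>R w) - f z)
     = h * (h * frechet_derivative (\<lambda>y. ?D y v) (at (z + s *\<^sub>R v + t *\<^sub>R w)) w)"
    using s_eq t_eq mem[OF s] mem'[OF s] S[OF s t] by (simp add: right_diff_distrib[symmetric])
  then show ?thesis using s t by (metis mult.assoc)
qed

text \<open>The second difference over the parallelogram spanned by \<open>h *\<^sub>R v\<close> and
  \<open>h *\<^sub>R w\<close> is symmetric in \<open>v\<close> and \<open>w\<close>. Divided by
  \<open>h * h\<close>, it is a value of either mixed derivative near \<open>z\<close>, and
  continuity brings both values back to \<open>z\<close> up to an arbitrary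
  \<open>e\<close>.\<close>

lemma second_derivative_symmetric:
  fixes f :: "'a::real_normed_vector \<Rightarrow> real"
  assumes "open S" and f: "Ck_on (Suc (Suc 0)) S f" and "z \<in> S"
  shows "frechet_derivative (\<lambda>y. frechet_derivative f (at y) v) (at z) w
    = frechet_derivative (\<lambda>y. frechet_derivative f (at y) w) (at z) v"
proof -
  let ?H = "\<lambda>v w y. frechet_derivative (\<lambda>y. frechet_derivative f (at y) v) (at y) w"
  have cont: "isCont (?H v w) z" for v w
    using f assms(1,3) by (simp add: continuous_on_eq_continuous_at)
  have "\<bar>?H v w z - ?H w v z\<bar> \<le> e" if "e > 0" for e
  proof -
    have near: "\<forall>\<^sub>F y in nhds z. \<bar>?H v w y - ?H v w z\<bar> < e / 2" for v w
      using tendstoD[OF tendsto_at_iff_tendsto_nhds[where g="?H v w", THEN iffD1,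
          OF cont[of v w, unfolded isCont_def]], of "e / 2"]
        \<open>e > 0\<close>
      by (simp add: dist_real_def)
    have "\<forall>\<^sub>F y in nhds z. y \<in> S" using assms(1,3) by (rule eventually_nhds_in_open)
    with near[of v w] near[of w v]
    have "\<forall>\<^sub>F y in nhds z. \<bar>?H v w y - ?H v w z\<bar> < e / 2 \<and> \<bar>?H w v y - ?H w v z\<bar> < e / 2 \<and> y \<in> S"
      by (intro eventually_conj)
    then obtain d where "d > 0" and d: "\<And>y. dist y z < d \<Longrightarrow>
      \<bar>?H v w y - ?H v w z\<bar> < e / 2 \<and> \<bar>?H w v y - ?H w v z\<bar> < e / 2 \<and> y \<in> S"
      unfolding eventually_nhds_metric by blast
    \<comment> \<open>This size keeps the whole parallelogram within distance \<open>d\<close> of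
      \<open>z\<close>; the summand 1 makes the denominator positive and the estimate
      strict.\<close>
    define h where "h = d / (norm v + norm w + 1)"
    have "norm v + norm w + 1 > 0" by (smt (verit) norm_ge_zero)
    then have "h > 0" and hd: "h * (norm v + norm w + 1) = d"
      using \<open>d > 0\<close> by (auto simp: h_def)
    have close: "dist (z + s *\<^sub>R v + t *\<^sub>R w) z < d" if "0 \<le> s" "s \<le> h" "0 \<le> t" "t \<le> h" for s t
    proof -
      have "dist (z + s *\<^sub>R v + t *\<^sub>R w) z = norm (s *\<^sub>R v + t *\<^sub>R w)"
        by (simp add: dist_norm add.assoc)
      also have "\<dots> \<le> s * norm v + t * norm w"
        using that norm_triangle_ineq[of "s *\<^sub>R v" "t *\<^sub>R w"] by simp
      also have "\<dots> \<le> h * norm v + h * norm w"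
        using that by (intro add_mono mult_right_mono) auto
      also have "\<dots> < d" using hd \<open>h > 0\<close> by (simp add: algebra_simps)
      finally show ?thesis .
    qed
    obtain s t where st: "0 \<le> s" "s \<le> h" "0 \<le> t" "t \<le> h" and
      1: "f (z + h *\<^sub>R v + h *\<^sub>R w) - f (z + h *\<^sub>R v) - (f (z + h *\<^sub>R w) - f z)
        = h * h * ?H v w (z + s *\<^sub>R v + t *\<^sub>R w)"
      using second_difference_mean_value[OF f \<open>h > 0\<close>, of z v w] close d by blast
    have close': "dist (z + s *\<^sub>R w + t *\<^sub>R v) z < d" if "0 \<le> s" "s \<le> h" "0 \<le> t" "t \<le> h" for s t
      using close[OF that(3,4,1,2)] by (simp add: algebra_simps)
    obtain s' t' where st': "0 \<le> s'" "s' \<le> h" "0 \<le> t'" "t' \<le> h" and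
      2: "f (z + h *\<^sub>R w + h *\<^sub>R v) - f (z + h *\<^sub>R w) - (f (z + h *\<^sub>R v) - f z)
        = h * h * ?H w v (z + s' *\<^sub>R w + t' *\<^sub>R v)"
      using second_difference_mean_value[OF f \<open>h > 0\<close>, of z w v] close' d by blast
    \<comment> \<open>Both sides are the same second difference with its two middle terms
      exchanged.\<close>
    have "h * h * ?H v w (z + s *\<^sub>R v + t *\<^sub>R w) = h * h * ?H w v (z + s' *\<^sub>R w + t' *\<^sub>R v)"
      using 1 2 by (simp add: algebra_simps)
    then have "?H v w (z + s *\<^sub>R v + t *\<^sub>R w) = ?H w v (z + s' *\<^sub>R w + t' *\<^sub>R v)"
      using \<open>h > 0\<close> by simp
    then show ?thesis
      using d[OF close[OF st]] d[OF close'[OF st']] by linarith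
  qed
  then show ?thesis
    by (metis abs_le_zero_iff dense_ge eq_iff_diff_eq_0)
qed


section \<open>Bump functions\<close>

text \<open>The span of these functions is closed under differentiation, hence they are smooth.\<close>

definition flat_quotient :: "nat \<Rightarrow> real \<Rightarrow> real" where
  "flat_quotient m t = (if t > 0 then exp (- inverse t) * inverse t ^ m else 0)"

text \<open>With \<open>s = inverse t\<close>, the exponential series dominates its term of index
  \<open>Suc m\<close>. The spare power of \<open>s\<close> leaves a factor \<open>t\<close>, which
  is what forces the limit 0 at the origin.\<close>

lemma flat_quotient_bound: "\<bar>flat_quotient m t\<bar> \<le> fact (Suc m) * \<bar>t\<bar>"
proof (cases "t > 0")
  case True
  define s where "s = inverse t"
  have s: "s > 0" "t = inverse s" using True by (auto simp: s_def)
  have "s ^ Suc m / fact (Suc m) \<le> exp s"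
    using sum_le_suminf[OF summable_exp, of "{Suc m}" s] s by (simp add: exp_def divide_inverse_commute)
  then have "s ^ Suc m * exp (- s) \<le> fact (Suc m)"
    by (simp add: exp_minus divide_simps mult.commute del: fact_Suc power_Suc)
  then have "exp (- s) * s ^ m \<le> fact (Suc m) * t"
    using s(1) unfolding s(2) divide_inverse[symmetric]
    by (simp only: pos_le_divide_eq power_Suc mult_ac)
  moreover have "flat_quotient m t = exp (- s) * s ^ m"
    using True by (simp add: flat_quotient_def s_def)
  ultimately show ?thesis using s(1) True by (simp del: fact_Suc)
next
  case False
  then have "flat_quotient m t = 0" by (simp add: flat_quotient_def)
  then show ?thesis by (simp del: fact_Suc)
qed

text \<open>Away from 0 this is ordinary differentiation. At 0 the difference quotient of
  \<open>flat_quotient m\<close> is \<open>flat_quotient (Suc m)\<close>, which tends to 0 by the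
  linear bound.\<close>

lemma flat_quotient_has_real_derivative:
  "(flat_quotient m has_real_derivative
    flat_quotient (m + 2) t - real m * flat_quotient (Suc m) t) (at t)"
proof -
  consider "t > 0" | "t < 0" | "t = 0" by linarith
  then show ?thesis
  proof cases
    case 1
    have "((\<lambda>t. exp (- inverse t) * inverse t ^ m) has_real_derivative
        flat_quotient (m + 2) t - real m * flat_quotient (Suc m) t) (at t)"
      using 1 by (auto intro!: derivative_eq_intros simp: flat_quotient_def power2_eq_square)
       (cases m; simp add: field_simps)
    then show ?thesis
      by (rule has_field_derivative_transform_within_open[where S="{0<..}"])
        (use 1 in \<open>auto simp: flat_quotient_def\<close>)
  next
    case 2
    have "((\<lambda>t. 0) has_real_derivative
        flat_quotient (m + 2) t - real m * flat_quotient (Suc m) t) (at t)"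
      using 2 by (auto simp: flat_quotient_def)
    then show ?thesis
      by (rule has_field_derivative_transform_within_open[where S="{..<0}"])
        (use 2 in \<open>auto simp: flat_quotient_def\<close>)
  next
    case 3
    have "(flat_quotient (Suc m) \<longlongrightarrow> 0) (at 0)"
    proof (rule Lim_null_comparison)
      show "\<forall>\<^sub>F t in at 0. norm (flat_quotient (Suc m) t) \<le> fact (Suc (Suc m)) * \<bar>t\<bar>"
        using flat_quotient_bound by (simp del: fact_Suc)
      show "((\<lambda>t. fact (Suc (Suc m)) * \<bar>t\<bar>) \<longlongrightarrow> 0) (at (0::real))"
        by (auto intro!: tendsto_eq_intros)
    qed
    moreover have "\<forall>\<^sub>F t in at 0. (flat_quotient m t - flat_quotient m 0) / (t - 0)
        = flat_quotient (Suc m) t"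
      by (auto simp: eventually_at_filter flat_quotient_def divide_inverse mult_ac intro!: always_eventually)
    ultimately have "((\<lambda>t. (flat_quotient m t - flat_quotient m 0) / (t - 0)) \<longlongrightarrow> 0) (at 0)"
      by (subst tendsto_cong)
    then show ?thesis
      using 3 by (simp add: has_field_derivative_iff flat_quotient_def)
  qed
qed

lemma smooth_on_flat_quotient: "smooth_on UNIV (flat_quotient m)"
proof -
  have D: "(flat_quotient m has_derivative
      (\<lambda>v. (flat_quotient (m + 2) t - real m * flat_quotient (Suc m) t) * v)) (at t)" for m t
    using flat_quotient_has_real_derivative by (simp add: has_field_derivative_def)
  have "Ck_on k UNIV (flat_quotient m)" for k
  proof (induction k arbitrary: m)
    case 0
    show ?case
      unfolding Ck_on.simps
      by (intro continuous_at_imp_continuous_on ballI DERIV_isCont[OF flat_quotient_has_real_derivative])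
  next
    case (Suc k)
    have "Ck_on k UNIV (\<lambda>t. (flat_quotient (m + 2) t + (- real m) * flat_quotient (Suc m) t) * v)" for v
      by (intro Ck_on_mult Ck_on_add Ck_on_const Suc open_UNIV)
    then have "Ck_on k UNIV (\<lambda>t. frechet_derivative (flat_quotient m) (at t) v)" for v
      by (simp add: frechet_derivative_at[OF D, symmetric])
    moreover have "flat_quotient m differentiable (at t)" for t
      using D unfolding differentiable_def by blast
    ultimately show ?case by simp
  qed
  then show ?thesis by (simp add: smooth_on_def)
qed

text \<open>The function is exp(-1/t) at \<open>t = r\<^sup>2 - (norm (y - z))\<^sup>2\<close>,
  extended by 0 and normalised by its value at the centre.\<close>

lemma smooth_bump_exists:
  fixes z :: "'a::euclidean_space"
  assumes "r > 0"
  obtains \<phi> :: "'a \<Rightarrow> real" where "smooth_on UNIV \<phi>" and "\<phi> z = 1"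
    and "\<And>y. y \<notin> cball z r \<Longrightarrow> \<phi> y = 0"
proof
  \<comment> \<open>Differences are written as sums with negatives to match the closure lemmas for
    \<open>smooth_on\<close>.\<close>
  let ?q = "\<lambda>y. r\<^sup>2 + - ((y + - z) \<bullet> (y + - z))"
  let ?\<phi> = "\<lambda>y. inverse (flat_quotient 0 (r\<^sup>2)) * flat_quotient 0 (?q y)"
  have "smooth_on UNIV ?q"
    by (intro smooth_on_add smooth_on_const smooth_on_minus smooth_on_inner smooth_on_id open_UNIV)
  then show "smooth_on UNIV ?\<phi>"
    by (intro smooth_on_mult smooth_on_const open_UNIV
        smooth_on_compose[OF _ smooth_on_flat_quotient]) auto
  show "?\<phi> z = 1" using assms by (simp add: flat_quotient_def)
  fix y assume "y \<notin> cball z r"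
  then have "r\<^sup>2 < (norm (y - z))\<^sup>2"
    using assms by (intro power_strict_mono) (auto simp: dist_norm norm_minus_commute)
  then show "?\<phi> y = 0" by (simp add: flat_quotient_def power2_norm_eq_inner)
qed


section \<open>Endomorphisms that are skew for a bilinear form\<close>

lemma axis_axis_nth: "axis i (axis j x) $ a $ b = (if i = a \<and> j = b then x else 0)"
  by (cases "a = i"; cases "b = j") (simp_all add: axis_def)

text \<open>The differences of a matrix unit and its transpose, one for each pair of distinct
  indices, span the skew-symmetric matrices. Their number is n(n - 1)/2; the additive form of the
  bound avoids subtraction and division of natural numbers.\<close>

lemma dim_skew_matrices_le:
  "2 * dim {M :: real^'n::finite^'n. \<forall>i j. M $ i $ j = - M $ j $ i} + CARD('n) \<le> CARD('n) * CARD('n)"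
proof -
  \<comment> \<open>The index type carries no order; an injection into the naturals selects one of
    (i, j) and (j, i).\<close>
  obtain f :: "'n \<Rightarrow> nat" where f: "inj f"
    using finite_imp_inj_to_nat_seg[of "UNIV :: 'n set"] by auto
  define E :: "'n \<times> 'n \<Rightarrow> real^'n^'n" where
    "E = (\<lambda>(i, j). axis i (axis j 1) - axis j (axis i 1))"
  define P where "P = {(i, j). f i < f j}"
  define P' where "P' = {(i, j). f j < f i}"
  let ?S = "{M :: real^'n^'n. \<forall>i j. M $ i $ j = - M $ j $ i}"
  have expand: "M = (\<Sum>p\<in>P. M $ fst p $ snd p *\<^sub>R E p)" if "M \<in> ?S" for M
  proof -
    have M: "M $ a $ b = - M $ b $ a" for a b using that by blast
    have entry: "M $ a $ b = (\<Sum>p\<in>P. M $ fst p $ snd p * E p $ a $ b)" for a b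
    proof -
      define m where "m = M $ a $ b"
      have m: "M $ a $ b = m" "M $ b $ a = - m" using M[of b a] by (auto simp: m_def)
      have "(\<Sum>p\<in>P. M $ fst p $ snd p * E p $ a $ b)
        = (\<Sum>p\<in>P. (if p = (a, b) then m else 0) + (if p = (b, a) then m else 0))"
      proof (intro sum.cong refl)
        fix p assume "p \<in> P"
        then obtain i j where p: "p = (i, j)" "i \<noteq> j" by (auto simp: P_def)
        have "E p $ a $ b = (if i = a \<and> j = b then 1 else 0) - (if j = a \<and> i = b then 1 else 0)"
          by (simp add: E_def p axis_axis_nth)
        moreover have "M $ i $ j *
            ((if i = a \<and> j = b then 1 else 0) - (if j = a \<and> i = b then 1 else 0))
          = (if i = a \<and> j = b then m else 0) + (if i = b \<and> j = a then m else 0)"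
        proof -
          consider "i = a" "j = b" | "j = a" "i = b" | "\<not> (i = a \<and> j = b)" "\<not> (j = a \<and> i = b)"
            by blast
          then show ?thesis
          proof cases
            case 1
            then have "\<not> (j = a \<and> i = b)" using p by blast
            with 1 show ?thesis by (simp only: m if_True if_False simp_thms) simp
          next
            case 2
            then have "\<not> (i = a \<and> j = b)" using p by blast
            with 2 show ?thesis by (simp only: m if_True if_False simp_thms) simp
          next
            case 3
            then show ?thesis by (simp only: m if_True if_False simp_thms conj_commute) simp
          qed
        qed
        ultimately show "M $ fst p $ snd p * E p $ a $ b
            = (if p = (a, b) then m else 0) + (if p = (b, a) then m else 0)"
          by (simp only: p(1) fst_conv snd_conv prod.inject)
      qed
      also have "\<dots> = (if (a, b) \<in> P then m else 0) + (if (b, a) \<in> P then m else 0)"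
        by (simp add: sum.distrib)
      \<comment> \<open>Off the diagonal exactly one of the two pairs lies in \<open>P\<close>. On
        the diagonal neither does, and \<open>m = - m\<close> gives 0.\<close>
      also have "\<dots> = m"
        using m injD[OF f, of a b] by (cases "f a" "f b" rule: linorder_cases) (auto simp: P_def)
      finally show ?thesis by (simp add: m_def)
    qed
    show ?thesis
      unfolding vec_eq_iff
      by (intro allI, rule trans[OF entry])
        (simp only: sum_component vector_scaleR_component real_scaleR_def)
  qed
  have "?S \<subseteq> span (E ` P)"
  proof
    fix M assume "M \<in> ?S"
    show "M \<in> span (E ` P)"
      by (subst expand[OF \<open>M \<in> ?S\<close>]) (intro span_sum span_scale span_base imageI)
  qed
  then have "dim ?S \<le> card (E ` P)" by (rule dim_le_card) (rule finite_imageI, rule finite_class.finite)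
  also have "\<dots> \<le> card P" by (rule card_image_le) (rule finite_class.finite)
  finally have dim: "dim ?S \<le> card P" .
  have swap: "card P' = card P"
    by (rule bij_betw_same_card[of prod.swap]) (auto simp: bij_betw_def inj_on_def P_def P'_def image_def)
  have un: "card (P \<union> P' \<union> range (\<lambda>i. (i, i))) = card P + card P' + CARD('n)"
  proof -
    have "card (range (\<lambda>i::'n. (i, i))) = CARD('n)" by (simp add: card_image inj_on_def)
    then show ?thesis
      by (subst card_Un_disjoint; (subst card_Un_disjoint)?) (auto simp: P_def P'_def)
  qed
  have univ: "P \<union> P' \<union> range (\<lambda>i. (i, i)) = UNIV"
    using injD[OF f] by (force simp: P_def P'_def image_iff)
  have "CARD('n) * CARD('n) = 2 * card P + CARD('n)"
    using un[unfolded univ] swap by simp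
  from ord_le_eq_trans[OF add_le_mono1[OF mult_le_mono2[OF dim]] this[symmetric]]
  show ?thesis .
qed

text \<open>For a nondegenerate symmetric \<open>B\<close> this is the orthogonal Lie algebra so(B),
  in matrix form to match \<open>curv_lie_algebra\<close>.\<close>

definition skew_endomorphisms :: "(real^'n \<Rightarrow> real^'n \<Rightarrow> real) \<Rightarrow> (real^'n^'n) set" where
  "skew_endomorphisms B = {M. \<forall>v w. B (M *v v) w + B v (M *v w) = 0}"

text \<open>Lowering an index sends \<open>M\<close> to the matrix with entries B(M e_i, e_j). This
  is injective because \<open>B\<close> is nondegenerate, and by symmetry of \<open>B\<close> it
  turns skewness for \<open>B\<close> into skew-symmetry of the matrix, whatever the
  signature.\<close>

lemma dim_skew_endomorphisms_le:
  fixes B :: "real^'n::finite \<Rightarrow> real^'n \<Rightarrow> real"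
  assumes "bilinear B" and "\<And>v w. B v w = B w v" and "\<And>v. \<forall>w. B v w = 0 \<Longrightarrow> v = 0"
  shows "2 * dim (skew_endomorphisms B) + CARD('n) \<le> CARD('n) * CARD('n)"
proof -
  define F :: "real^'n^'n \<Rightarrow> real^'n^'n" where
    "F M = (\<chi> i j. B (M *v axis i 1) (axis j 1))" for M
  have F: "linear F"
    using assms(1)
    by (intro linearI) (simp_all add: F_def vec_eq_iff matrix_vector_mult_add_rdistrib
        bilinear_ladd scaleR_matrix_vector_assoc[symmetric] bilinear_lmul)
  have "inj F"
  proof (rule linear_injective_0[OF F, THEN iffD2], intro allI impI)
    fix M assume "F M = 0"
    then have 0: "B (M *v axis i 1) (axis j 1) = 0" for i j
      by (simp add: F_def vec_eq_iff)
    have "B (M *v axis i 1) w = 0" for i w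
    proof -
      have "linear (B (M *v axis i 1))" using assms(1) by (simp add: bilinear_def)
      then have "B (M *v axis i 1) w = (\<Sum>b\<in>Basis. (w \<bullet> b) *\<^sub>R B (M *v axis i 1) b)"
        by (rule linear_euclidean_expand)
      also have "\<dots> = 0" using 0 by (intro sum.neutral) (auto simp: Basis_vec_def)
      finally show ?thesis .
    qed
    then have "M *v axis i 1 = 0" for i using assms(3) by blast
    then show "M = 0"
      by (metis matrix_vector_mult_basis column_def vec_lambda_beta vec_eq_iff zero_index)
  qed
  then have "dim (skew_endomorphisms B) = dim (F ` skew_endomorphisms B)"
    by (intro dim_image_eq[OF F, symmetric]) (auto intro: inj_on_subset)
  also have "\<dots> \<le> dim {M :: real^'n^'n. \<forall>i j. M $ i $ j = - M $ j $ i}"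
  proof (rule dim_subset, clarify)
    fix M :: "real^'n^'n" and i j assume "M \<in> skew_endomorphisms B"
    then have "B (M *v axis i 1) (axis j 1) + B (axis i 1) (M *v axis j 1) = 0"
      by (simp add: skew_endomorphisms_def)
    then show "F M $ i $ j = - F M $ j $ i"
      using assms(2) by (simp add: F_def)
  qed
  finally show ?thesis using dim_skew_matrices_le[where 'n='n] by linarith
qed

text \<open>Moving a product across \<open>B\<close> costs two signs and reverses the order of the
  factors, so a commutator changes sign.\<close>

lemma lie_subalgebra_skew_endomorphisms:
  fixes B :: "real^'n::finite \<Rightarrow> real^'n \<Rightarrow> real"
  assumes "bilinear B"
  shows "lie_subalgebra (skew_endomorphisms B)"
proof -
  note l = bilinear_ladd[OF assms] bilinear_radd[OF assms] bilinear_lmul[OF assms]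
    bilinear_rmul[OF assms] bilinear_lsub[OF assms] bilinear_rsub[OF assms]
    bilinear_lzero[OF assms] bilinear_rzero[OF assms]
  have "subspace (skew_endomorphisms B)"
    unfolding subspace_def skew_endomorphisms_def
    by (auto simp: l matrix_vector_mult_add_rdistrib scaleR_matrix_vector_assoc[symmetric])
      (smt (verit) distrib_left mult_zero_right)+
  moreover have "P ** Q - Q ** P \<in> skew_endomorphisms B"
    if "P \<in> skew_endomorphisms B" "Q \<in> skew_endomorphisms B" for P Q
  proof -
    have P: "B (P *v v) w = - B v (P *v w)" and Q: "B (Q *v v) w = - B v (Q *v w)" for v w
      using that by (auto simp: skew_endomorphisms_def add_eq_0_iff)
    show ?thesis
      by (simp add: skew_endomorphisms_def l matrix_vector_mult_diff_rdistrib
          matrix_vector_mul_assoc[symmetric] P Q)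
  qed
  ultimately show ?thesis by (simp add: lie_subalgebra_def)
qed

text \<open>\<open>matrix f\<close> records only the values of \<open>f\<close> on the standard
  basis. There the identity is given, and for the linear map of \<open>matrix f\<close> it extends
  bilinearly. So the lemma applies to \<open>curv_endo\<close> without first establishing that it is
  linear.\<close>

lemma matrix_mem_skew_endomorphisms:
  fixes B :: "real^'n::finite \<Rightarrow> real^'n \<Rightarrow> real"
  assumes "bilinear B" and f: "\<And>v w. B (f v) w + B v (f w) = 0"
  shows "matrix f \<in> skew_endomorphisms B"
proof -
  let ?C = "\<lambda>v w. B (matrix f *v v) w + B v (matrix f *v w)"
  have col: "matrix f *v axis i 1 = f (axis i 1)" for i
    by (simp add: matrix_vector_mult_basis column_def matrix_def vec_eq_iff)
  have "bilinear ?C"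
    unfolding bilinear_def
    by (intro conjI allI linearI) (simp_all add: bilinear_ladd[OF assms(1)] bilinear_radd[OF assms(1)]
        bilinear_lmul[OF assms(1)] bilinear_rmul[OF assms(1)] matrix_vector_right_distrib
        matrix_vector_mult_scaleR distrib_left)
  then have "?C = (\<lambda>v w. 0)"
    by (rule bilinear_eq_stdbasis)
      (auto simp: bilinear_def linear_zero Basis_vec_def col f)
  then show ?thesis by (auto simp: skew_endomorphisms_def dest: fun_cong)
qed


section \<open>Vector fields on an analytic manifold\<close>

locale analytic_manifold =
  fixes A :: "('m::{t2_space, second_countable_topology}, 'n::finite) chart set"
  assumes atlas: "analytic_atlas A"
begin

section \<open>Charts and differentials of transition maps\<close>

lemma chart_at_mem: "chart_at A p \<in> A" "p \<in> fst (chart_at A p)"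
proof -
  have "\<exists>c. c \<in> A \<and> p \<in> fst c"
    using atlas unfolding analytic_atlas_def by blast
  from someI_ex[OF this] show "chart_at A p \<in> A" "p \<in> fst (chart_at A p)"
    unfolding chart_at_def by auto
qed

lemma chart:
  assumes "c \<in> A"
  shows open_chart_dom: "open (fst c)"
    and open_chart_image: "open (chart_image c)"
    and chart_homeomorphism: "homeomorphism (fst c) (chart_image c) (snd c) (chart_inv c)"
  using atlas assms unfolding analytic_atlas_def by blast+

lemma chart_inv_chart [simp]: "c \<in> A \<Longrightarrow> p \<in> fst c \<Longrightarrow> chart_inv c (snd c p) = p"
  using chart_homeomorphism by (auto simp: homeomorphism_def)

lemma chart_chart_inv [simp]: "c \<in> A \<Longrightarrow> z \<in> chart_image c \<Longrightarrow> snd c (chart_inv c z) = z"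
  using chart_homeomorphism by (auto simp: homeomorphism_def)

lemma chart_inv_mem [simp]: "c \<in> A \<Longrightarrow> z \<in> chart_image c \<Longrightarrow> chart_inv c z \<in> fst c"
  using chart_homeomorphism[of c] unfolding homeomorphism_def by blast

lemma chart_mem_image [simp]: "p \<in> fst c \<Longrightarrow> snd c p \<in> chart_image c"
  by (simp add: chart_image_def)

text \<open>Written as a preimage under the continuous \<open>chart_inv c\<close>, the set is
  visibly open when \<open>U\<close> is.\<close>

lemma chart_image_Int:
  "c \<in> A \<Longrightarrow> snd c ` (fst c \<inter> U) = chart_image c \<inter> chart_inv c -` U"
  by (force simp: image_iff chart_image_def)

lemma open_chart_image_Int:
  assumes "c \<in> A" and "open U"
  shows "open (snd c ` (fst c \<inter> U))"
  using assms chart_homeomorphism[OF assms(1)]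
  by (simp add: chart_image_Int homeomorphism_def continuous_open_preimage open_chart_image)

lemma smooth_transition:
  "c \<in> A \<Longrightarrow> d \<in> A \<Longrightarrow> smooth_on (snd c ` (fst c \<inter> fst d)) (snd d \<circ> chart_inv c)"
  using atlas unfolding analytic_atlas_def real_analytic_on_def by blast

lemma transition_has_derivative:
  assumes "c \<in> A" "d \<in> A" "p \<in> fst c" "p \<in> fst d"
  shows "((snd d \<circ> chart_inv c) has_derivative transition_diff c d p) (at (snd c p))"
  using smooth_on_differentiable[OF smooth_transition[OF assms(1,2)], of "snd c p"] assms
  unfolding transition_diff_def by (simp add: frechet_derivative_works)

lemma linear_transition_diff:
  "c \<in> A \<Longrightarrow> d \<in> A \<Longrightarrow> p \<in> fst c \<Longrightarrow> p \<in> fst d \<Longrightarrow> linear (transition_diff c d p)"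
  by (blast intro: has_derivative_linear transition_has_derivative)

text \<open>This is the chain rule: on the overlap with the domain of \<open>d\<close>, passing from
  \<open>c\<close> through \<open>d\<close> to \<open>e\<close> agrees with passing from
  \<open>c\<close> to \<open>e\<close> directly.\<close>

lemma transition_diff_cocycle:
  assumes "c \<in> A" "d \<in> A" "e \<in> A" "p \<in> fst c" "p \<in> fst d" "p \<in> fst e"
  shows "transition_diff d e p (transition_diff c d p v) = transition_diff c e p v"
proof -
  have "((snd e \<circ> chart_inv d) has_derivative transition_diff d e p)
      (at ((snd d \<circ> chart_inv c) (snd c p)))"
    using transition_has_derivative[of d e p] assms by simp
  from diff_chain_at[OF transition_has_derivative[OF assms(1,2,4,5)] this]
  have "(((snd e \<circ> chart_inv d) \<circ> (snd d \<circ> chart_inv c)) has_derivative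
      transition_diff d e p \<circ> transition_diff c d p) (at (snd c p))" .
  then have "((snd e \<circ> chart_inv c) has_derivative
      transition_diff d e p \<circ> transition_diff c d p) (at (snd c p))"
    by (rule has_derivative_transform_within_open[OF _
          open_chart_image_Int[OF assms(1) open_chart_dom[OF assms(2)]]])
      (use assms in auto)
  then have "transition_diff d e p \<circ> transition_diff c d p = transition_diff c e p"
    using transition_has_derivative[of c e p] assms has_derivative_unique by blast
  then show ?thesis by (metis comp_apply)
qed

lemma transition_diff_self:
  assumes "c \<in> A" "p \<in> fst c"
  shows "transition_diff c c p v = v"
proof -
  have "((\<lambda>z. z) has_derivative (\<lambda>v. v)) (at (snd c p))" by simp
  then have "((snd c \<circ> chart_inv c) has_derivative (\<lambda>v. v)) (at (snd c p))"
    by (rule has_derivative_transform_within_open[OF _ open_chart_image[OF assms(1)]])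
      (use assms in auto)
  then have "transition_diff c c p = (\<lambda>v. v)"
    using transition_has_derivative[of c c p] assms has_derivative_unique by blast
  then show ?thesis by simp
qed

section \<open>Coordinates and extension of vector fields\<close>

lemma vf_coord_chart:
  "c \<in> A \<Longrightarrow> p \<in> fst c \<Longrightarrow> vf_coord A c X (snd c p) = transition_diff (chart_at A p) c p (X p)"
  by (simp add: vf_coord_def)

lemma vf_coord_chart_at: "vf_coord A (chart_at A p) X (snd (chart_at A p) p) = X p"
  by (simp add: vf_coord_chart chart_at_mem transition_diff_self)

lemma transition_diff_vf_coord:
  assumes "c \<in> A" "p \<in> fst c"
  shows "transition_diff c (chart_at A p) p (vf_coord A c X (snd c p)) = X p"
  using assms by (simp add: vf_coord_chart chart_at_mem transition_diff_cocycle transition_diff_self)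

lemma smooth_vf_D:
  assumes "smooth_vf A X" "c \<in> A"
  shows "smooth_on (chart_image c) (vf_coord A c X)"
  using assms by (simp add: smooth_vf_def)

lemma smooth_vf_add:
  assumes "smooth_vf A X" "smooth_vf A Y"
  shows "smooth_vf A (\<lambda>p. X p + Y p)"
  unfolding smooth_vf_def
proof
  fix c assume c: "c \<in> A"
  have "vf_coord A c (\<lambda>p. X p + Y p) z = vf_coord A c X z + vf_coord A c Y z"
    if "z \<in> chart_image c" for z
    using linear_add[OF linear_transition_diff] c that by (simp add: vf_coord_def chart_at_mem Let_def)
  moreover have "smooth_on (chart_image c) (\<lambda>z. vf_coord A c X z + vf_coord A c Y z)"
    by (intro smooth_on_add smooth_vf_D assms c open_chart_image)
  ultimately show "smooth_on (chart_image c) (vf_coord A c (\<lambda>p. X p + Y p))"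
    by (rule smooth_on_congI[OF open_chart_image[OF c]])
qed

lemma smooth_vf_minus:
  assumes "smooth_vf A X"
  shows "smooth_vf A (\<lambda>p. - X p)"
  unfolding smooth_vf_def
proof
  fix c assume c: "c \<in> A"
  have "vf_coord A c (\<lambda>p. - X p) z = - vf_coord A c X z" if "z \<in> chart_image c" for z
    using linear_neg[OF linear_transition_diff] c that by (simp add: vf_coord_def chart_at_mem Let_def)
  moreover have "smooth_on (chart_image c) (\<lambda>z. - vf_coord A c X z)"
    by (intro smooth_on_minus smooth_vf_D assms c open_chart_image)
  ultimately show "smooth_on (chart_image c) (vf_coord A c (\<lambda>p. - X p))"
    by (rule smooth_on_congI[OF open_chart_image[OF c]])
qed

lemma smooth_vf_diff:
  "smooth_vf A X \<Longrightarrow> smooth_vf A Y \<Longrightarrow> smooth_vf A (\<lambda>p. X p - Y p)"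
  using smooth_vf_add[OF _ smooth_vf_minus] by simp

lemma smooth_vf_zero: "smooth_vf A (\<lambda>p. 0)"
  unfolding smooth_vf_def
proof
  fix c assume c: "c \<in> A"
  have "vf_coord A c (\<lambda>p. 0) z = 0" if "z \<in> chart_image c" for z
    using linear_0[OF linear_transition_diff] c that by (simp add: vf_coord_def chart_at_mem Let_def)
  then show "smooth_on (chart_image c) (vf_coord A c (\<lambda>p. 0))"
    by (rule smooth_on_congI[OF open_chart_image[OF c]]) (simp_all add: smooth_on_const)
qed

lemma smooth_vf_sum:
  "(\<And>i. i \<in> I \<Longrightarrow> smooth_vf A (X i)) \<Longrightarrow> smooth_vf A (\<lambda>p. \<Sum>i\<in>I. X i p)"
  by (induction I rule: infinite_finite_induct) (simp_all add: smooth_vf_zero smooth_vf_add)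

text \<open>Take the field with constant coordinates \<open>v\<close> in the preferred chart of
  \<open>x\<close>, cut it off by a bump function supported in a closed ball inside the chart image,
  and extend it by 0.\<close>

lemma smooth_vf_extension: "\<exists>X. smooth_vf A X \<and> X x = v"
proof -
  define c where "c = chart_at A x"
  have c: "c \<in> A" "x \<in> fst c" by (simp_all add: c_def chart_at_mem)
  obtain r where "r > 0" and r: "cball (snd c x) r \<subseteq> chart_image c"
    using open_chart_image[OF c(1)] c(2) open_contains_cball by (metis chart_mem_image)
  obtain \<phi> :: "real^'n \<Rightarrow> real" where \<phi>: "smooth_on UNIV \<phi>" "\<phi> (snd c x) = 1"
    and supp: "\<And>y. y \<notin> cball (snd c x) r \<Longrightarrow> \<phi> y = 0"
    by (rule smooth_bump_exists[OF \<open>r > 0\<close>, of "snd c x"]) (rule that)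
  \<comment> \<open>\<open>K\<close> is compact and the manifold is Hausdorff, so \<open>K\<close>
    is closed. Its complement and the chart domain are then two open sets covering the manifold, and
    \<open>X\<close> is smooth on each.\<close>
  define K where "K = chart_inv c ` cball (snd c x) r"
  have "continuous_on (cball (snd c x) r) (chart_inv c)"
    by (rule continuous_on_subset[OF _ r])
      (use chart_homeomorphism[OF c(1)] in \<open>simp add: homeomorphism_def\<close>)
  then have "closed K" unfolding K_def by (intro compact_imp_closed compact_continuous_image) auto
  define X where "X p = (if p \<in> fst c then
    \<phi> (snd c p) *\<^sub>R transition_diff c (chart_at A p) p v else 0)" for p
  have X0: "X p = 0" if "p \<notin> K" for p
    using that supp[of "snd c p"] c by (force simp: X_def K_def image_iff)
  have "smooth_vf A X"
    unfolding smooth_vf_def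
  proof
    fix d assume d: "d \<in> A"
    let ?\<psi> = "snd c \<circ> chart_inv d"
    let ?U = "snd d ` (fst d \<inter> fst c)" and ?V = "snd d ` (fst d \<inter> - K)"
    have U: "open ?U" and V: "open ?V"
      using d c \<open>closed K\<close> by (simp_all add: open_chart_image_Int open_chart_dom open_Compl)
    have "smooth_on ?U (vf_coord A d X)"
    proof -
      have "vf_coord A d X z = \<phi> (?\<psi> z) *\<^sub>R frechet_derivative (snd d \<circ> chart_inv c) (at (?\<psi> z)) v"
        if "z \<in> ?U" for z
      proof -
        from that obtain p where p: "z = snd d p" "p \<in> fst d" "p \<in> fst c" by blast
        have "vf_coord A d X z = \<phi> (snd c p) *\<^sub>R transition_diff c d p v"
          using p c d linear_scale[OF linear_transition_diff[of "chart_at A p" d p]]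
          by (simp add: vf_coord_chart X_def chart_at_mem transition_diff_cocycle)
        then show ?thesis using p c d by (simp add: transition_diff_def)
      qed
      moreover have "smooth_on ?U (\<lambda>z. \<phi> (?\<psi> z) *\<^sub>R
          frechet_derivative (snd d \<circ> chart_inv c) (at (?\<psi> z)) v)"
      proof (intro smooth_on_scaleR U)
        have \<psi>: "smooth_on ?U ?\<psi>" using smooth_transition[OF d c(1)] .
        show "smooth_on ?U (\<lambda>z. \<phi> (?\<psi> z))"
          by (rule smooth_on_compose[OF U \<phi>(1) \<psi>]) simp
        \<comment> \<open>The direction \<open>v\<close> is fixed and only the base point moves, so
          this is a directional derivative of a smooth transition map composed with
          \<open>?\<psi>\<close>.\<close>
        show "smooth_on ?U (\<lambda>z. frechet_derivative (snd d \<circ> chart_inv c) (at (?\<psi> z)) v)"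
          by (rule smooth_on_compose[OF U
              smooth_on_frechet_derivative[OF smooth_transition[OF c(1) d], of v] \<psi>])
            (use c d in auto)
      qed
      ultimately show ?thesis by (rule smooth_on_congI[OF U])
    qed
    moreover have "smooth_on ?V (vf_coord A d X)"
    proof -
      have "vf_coord A d X z = (\<lambda>z. 0) z" if "z \<in> ?V" for z
      proof -
        from that obtain p where p: "z = snd d p" "p \<in> fst d" "p \<notin> K" by blast
        then show ?thesis
          using d X0 linear_0[OF linear_transition_diff[OF chart_at_mem(1) d chart_at_mem(2) p(2)]]
          by (simp add: vf_coord_chart)
      qed
      then show ?thesis by (rule smooth_on_congI[OF V]) (simp_all add: smooth_on_const)
    qed
    moreover have "z \<in> ?U \<or> z \<in> ?V" if "z \<in> chart_image d" for z
    proof -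
      have "K \<subseteq> fst c" using r c unfolding K_def by (auto dest: subsetD)
      then show ?thesis using that d by (auto simp: chart_image_Int)
    qed
    ultimately show "smooth_on (chart_image d) (vf_coord A d X)"
      using U V by (intro smooth_on_locally) metis
  qed
  moreover have "X x = v"
    using c \<phi>(2) by (simp add: X_def c_def[symmetric] transition_diff_self)
  ultimately show ?thesis by blast
qed

lemma extend_vf: "smooth_vf A (extend_vf A x v)" "extend_vf A x v x = v"
  using someI_ex[OF smooth_vf_extension[of x v]] unfolding extend_vf_def by auto

section \<open>Directional derivatives of functions\<close>

lemma smooth_fun_D: "smooth_fun A f \<Longrightarrow> c \<in> A \<Longrightarrow> smooth_on (chart_image c) (f \<circ> chart_inv c)"
  by (simp add: smooth_fun_def)

text \<open>\<open>dir_deriv\<close> uses the preferred chart of \<open>p\<close>, which varies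
  arbitrarily with \<open>p\<close>. Differentiating a second time requires a formula in one chart
  for all nearby points, which the chain rule supplies.\<close>

lemma dir_deriv_chart:
  assumes "smooth_fun A f" "c \<in> A" "p \<in> fst c"
  shows "dir_deriv A X f p =
    frechet_derivative (f \<circ> chart_inv c) (at (snd c p)) (vf_coord A c X (snd c p))"
proof -
  define d where "d = chart_at A p"
  have d: "d \<in> A" "p \<in> fst d" by (simp_all add: d_def chart_at_mem)
  have "((f \<circ> chart_inv c) has_derivative frechet_derivative (f \<circ> chart_inv c) (at (snd c p)))
      (at ((snd c \<circ> chart_inv d) (snd d p)))"
    using smooth_on_differentiable[OF smooth_fun_D[OF assms(1,2)], of "snd c p"] assms d
    by (simp add: frechet_derivative_works)
  from diff_chain_at[OF transition_has_derivative[OF d(1) assms(2) d(2) assms(3)] this]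
  have "(((f \<circ> chart_inv c) \<circ> (snd c \<circ> chart_inv d)) has_derivative
      frechet_derivative (f \<circ> chart_inv c) (at (snd c p)) \<circ> transition_diff d c p) (at (snd d p))" .
  then have "((f \<circ> chart_inv d) has_derivative
      frechet_derivative (f \<circ> chart_inv c) (at (snd c p)) \<circ> transition_diff d c p) (at (snd d p))"
    by (rule has_derivative_transform_within_open[OF _
          open_chart_image_Int[OF d(1) open_chart_dom[OF assms(2)]]])
      (use assms d in auto)
  from frechet_derivative_at[OF this, symmetric] show ?thesis
    using assms by (simp add: dir_deriv_def vf_coord_chart Let_def flip: d_def)
qed

lemma dir_deriv_const: "dir_deriv A X (\<lambda>p. c) p = 0"
  by (simp add: dir_deriv_def o_def)

lemma dir_deriv_add:
  assumes "smooth_fun A f" "smooth_fun A h"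
  shows "dir_deriv A X (\<lambda>p. f p + h p) p = dir_deriv A X f p + dir_deriv A X h p"
proof -
  define c where "c = chart_at A p"
  have c: "c \<in> A" "p \<in> fst c" by (simp_all add: c_def chart_at_mem)
  have "(k \<circ> chart_inv c) differentiable (at (snd c p))" if "smooth_fun A k" for k
    using smooth_on_differentiable[OF smooth_fun_D[OF that c(1)]] c by simp
  from has_derivative_add[OF this[OF assms(1), unfolded frechet_derivative_works]
      this[OF assms(2), unfolded frechet_derivative_works]]
  have "(((\<lambda>p. f p + h p) \<circ> chart_inv c) has_derivative
      (\<lambda>v. frechet_derivative (f \<circ> chart_inv c) (at (snd c p)) v
        + frechet_derivative (h \<circ> chart_inv c) (at (snd c p)) v)) (at (snd c p))"
    by (simp add: o_def)
  from frechet_derivative_at[OF this, symmetric] show ?thesis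
    by (simp add: dir_deriv_def Let_def flip: c_def)
qed

text \<open>In coordinates, differentiating along \<open>Y\<close> and then \<open>X\<close> gives
  the Hessian of \<open>f\<close> on the two fields plus the differential of \<open>f\<close> on the
  derivative of \<open>Y\<close> along \<open>X\<close>. The Hessian is symmetric, so only the
  coordinate formula for the bracket survives.\<close>

lemma dir_deriv_commutator:
  assumes f: "smooth_fun A f" and X: "smooth_vf A X" and Y: "smooth_vf A Y"
  shows "dir_deriv A X (dir_deriv A Y f) p - dir_deriv A Y (dir_deriv A X f) p
    = dir_deriv A (lie_bracket A X Y) f p"
proof -
  define c where "c = chart_at A p"
  define z where "z = snd c p"
  have c: "c \<in> A" "p \<in> fst c" by (simp_all add: c_def chart_at_mem)
  then have z: "z \<in> chart_image c" by (simp add: z_def)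
  define F where "F = f \<circ> chart_inv c"
  have F: "smooth_on (chart_image c) F" using smooth_fun_D[OF f c(1)] by (simp add: F_def)
  define D where "D = (\<lambda>y. frechet_derivative F (at y))"
  define H where "H = (\<lambda>b. frechet_derivative (\<lambda>y. D y b) (at z))"
  have D: "(F has_derivative D y) (at y)" if "y \<in> chart_image c" for y
    using smooth_on_differentiable[OF F that] by (simp add: D_def frechet_derivative_works)
  have H: "((\<lambda>y. D y b) has_derivative H b) (at z)" for b
    using smooth_on_differentiable[OF smooth_on_frechet_derivative[OF F] z]
    by (simp add: D_def H_def frechet_derivative_works)
  have H_sym: "H a b = H b a" for a b
    using second_derivative_symmetric[OF open_chart_image[OF c(1)] smooth_on_Ck[OF F] z]
    by (simp add: H_def D_def)
  have second: "dir_deriv A V (dir_deriv A W f) p =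
      (\<Sum>a\<in>Basis. \<Sum>b\<in>Basis. (W p \<bullet> a) * (V p \<bullet> b) * H a b)
      + D z (frechet_derivative (vf_coord A c W) (at z) (V p))"
    if "smooth_vf A W" for V W
  proof -
    let ?w = "vf_coord A c W"
    have w: "(?w has_derivative frechet_derivative ?w (at z)) (at z)"
      using smooth_on_differentiable[OF smooth_vf_D[OF that c(1)] z]
      by (simp add: frechet_derivative_works)
    have wz: "?w z = W p" unfolding z_def c_def by (rule vf_coord_chart_at)
    \<comment> \<open>The basis expansion reduces the derivative of \<open>D y (?w y)\<close>, where
      base point and direction both move, to the product rule.\<close>
    have eq: "(dir_deriv A W f \<circ> chart_inv c) y = (\<Sum>a\<in>Basis. (?w y \<bullet> a) * D y a)"
      if "y \<in> chart_image c" for y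
    proof -
      have "(dir_deriv A W f \<circ> chart_inv c) y = D y (?w y)"
        using dir_deriv_chart[OF f c(1), of "chart_inv c y" W] c that by (simp add: D_def F_def)
      then show ?thesis
        using linear_euclidean_expand[OF has_derivative_linear[OF D[OF that]], of "?w y"] by simp
    qed
    have "((\<lambda>y. \<Sum>a\<in>Basis. (?w y \<bullet> a) * D y a) has_derivative
        (\<lambda>v. \<Sum>a\<in>Basis. (?w z \<bullet> a) * H a v + (frechet_derivative ?w (at z) v \<bullet> a) * D z a)) (at z)"
      by (intro has_derivative_sum has_derivative_mult has_derivative_inner_left w H)
    then have "((dir_deriv A W f \<circ> chart_inv c) has_derivative
        (\<lambda>v. \<Sum>a\<in>Basis. (?w z \<bullet> a) * H a v + (frechet_derivative ?w (at z) v \<bullet> a) * D z a)) (at z)"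
      by (rule has_derivative_transform_within_open[OF _ open_chart_image[OF c(1)] z]) (rule eq[symmetric])
    from frechet_derivative_at[OF this, symmetric]
    have "dir_deriv A V (dir_deriv A W f) p = (\<Sum>a\<in>Basis. (W p \<bullet> a) * H a (V p))
        + (\<Sum>a\<in>Basis. (frechet_derivative ?w (at z) (V p) \<bullet> a) * D z a)"
      by (simp add: dir_deriv_def Let_def wz sum.distrib flip: c_def z_def)
    moreover have "(\<Sum>a\<in>Basis. (frechet_derivative ?w (at z) (V p) \<bullet> a) * D z a)
        = D z (frechet_derivative ?w (at z) (V p))"
      using linear_euclidean_expand[OF has_derivative_linear[OF D[OF z]],
          of "frechet_derivative ?w (at z) (V p)"] by simp
    moreover have "(W p \<bullet> a) * H a (V p) = (\<Sum>b\<in>Basis. (W p \<bullet> a) * (V p \<bullet> b) * H a b)" for a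
      using linear_euclidean_expand[OF has_derivative_linear[OF H], of a "V p"]
      by (simp add: sum_distrib_left mult.assoc)
    ultimately show ?thesis by simp
  qed
  \<comment> \<open>The Hessian terms of the two orders of differentiation agree.\<close>
  have "(\<Sum>a\<in>Basis. \<Sum>b\<in>Basis. (Y p \<bullet> a) * (X p \<bullet> b) * H a b)
      = (\<Sum>a\<in>Basis. \<Sum>b\<in>Basis. (X p \<bullet> a) * (Y p \<bullet> b) * H a b)"
    by (subst sum.swap) (intro sum.cong refl, simp add: H_sym mult_ac)
  moreover have "dir_deriv A (lie_bracket A X Y) f p =
      D z (frechet_derivative (vf_coord A c Y) (at z) (X p))
      - D z (frechet_derivative (vf_coord A c X) (at z) (Y p))"
    by (simp add: dir_deriv_def lie_bracket_def Let_def D_def F_def z_def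
        linear_diff[OF has_derivative_linear[OF D[OF z, unfolded D_def F_def z_def]]] flip: c_def)
  ultimately show ?thesis by (simp add: second[OF X] second[OF Y])
qed

end


section \<open>Skewness of the curvature of a Levi-Civita connection\<close>

locale levi_civita_manifold = analytic_manifold A
  for A :: "('m::{t2_space, second_countable_topology}, 'n::finite) chart set" +
  fixes g :: "'m \<Rightarrow> real^'n \<Rightarrow> real^'n \<Rightarrow> real"
    and nabla :: "('m, 'n) vfield \<Rightarrow> ('m, 'n) vfield \<Rightarrow> ('m, 'n) vfield"
  assumes metric: "pseudo_riemannian_metric A g"
    and levi_civita: "levi_civita A g nabla"
begin

section \<open>Calculus with the metric and its connection\<close>

lemma bilinear_metric: "bilinear (g p)"
  and metric_sym: "g p v w = g p w v"
  and metric_nondegenerate: "\<forall>w. g p v w = 0 \<Longrightarrow> v = 0"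
  using metric unfolding pseudo_riemannian_metric_def by blast+

lemmas metric_simps = bilinear_ladd[OF bilinear_metric] bilinear_radd[OF bilinear_metric]
  bilinear_lsub[OF bilinear_metric] bilinear_rsub[OF bilinear_metric]

lemma metric_sum_left: "g p (\<Sum>i\<in>I. f i) w = (\<Sum>i\<in>I. g p (f i) w)"
  using linear_sum[of "\<lambda>v. g p v w"] bilinear_metric[of p] by (simp add: bilinear_def)

lemma metric_sum_right: "g p v (\<Sum>i\<in>I. f i) = (\<Sum>i\<in>I. g p v (f i))"
  using linear_sum[of "g p v"] bilinear_metric[of p] by (simp add: bilinear_def)

lemma smooth_vf_nabla: "smooth_vf A X \<Longrightarrow> smooth_vf A Y \<Longrightarrow> smooth_vf A (nabla X Y)"
  using levi_civita unfolding levi_civita_def affine_connection_def by blast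

text \<open>Vanishing torsion expresses the bracket through two covariant derivatives, whose
  smoothness is part of being a connection.\<close>

lemma smooth_vf_lie_bracket:
  assumes "smooth_vf A X" "smooth_vf A Y"
  shows "smooth_vf A (lie_bracket A X Y)"
proof -
  have "(\<lambda>p. nabla X Y p - nabla Y X p) = lie_bracket A X Y"
    using levi_civita assms unfolding levi_civita_def torsion_free_def by blast
  then show ?thesis
    using smooth_vf_diff[OF smooth_vf_nabla smooth_vf_nabla, OF assms assms(2,1)] by simp
qed

lemma dir_deriv_metric:
  assumes "smooth_vf A X" "smooth_vf A Y" "smooth_vf A Z"
  shows "dir_deriv A X (\<lambda>p. g p (Y p) (Z p)) =
    (\<lambda>p. g p (nabla X Y p) (Z p) + g p (Y p) (nabla X Z p))"
  using levi_civita assms unfolding levi_civita_def by blast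

text \<open>Smoothness of the metric is given only on constant coordinate vectors; expanding both
  fields in a chart reduces to those components.\<close>

lemma smooth_fun_metric:
  assumes "smooth_vf A Y" "smooth_vf A Z"
  shows "smooth_fun A (\<lambda>p. g p (Y p) (Z p))"
  unfolding smooth_fun_def
proof
  fix c assume c: "c \<in> A"
  let ?y = "vf_coord A c Y" and ?z = "vf_coord A c Z"
  define G where "G v w z = (let p = chart_inv c z; T = transition_diff c (chart_at A p) p
    in g p (T v) (T w))" for v w z
  have G: "smooth_on (chart_image c) (G v w)" for v w
    using metric c unfolding pseudo_riemannian_metric_def G_def by blast
  have "((\<lambda>p. g p (Y p) (Z p)) \<circ> chart_inv c) z
      = (\<Sum>a\<in>Basis. \<Sum>b\<in>Basis. (?y z \<bullet> a) *\<^sub>R (?z z \<bullet> b) *\<^sub>R G a b z)"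
    if "z \<in> chart_image c" for z
  proof -
    define p where "p = chart_inv c z"
    define T where "T = transition_diff c (chart_at A p) p"
    have p: "p \<in> fst c" "snd c p = z" using c that by (simp_all add: p_def)
    have "linear T" using c p by (simp add: T_def linear_transition_diff chart_at_mem)
    have T: "T v = (\<Sum>b\<in>Basis. (v \<bullet> b) *\<^sub>R T b)" for v
      by (rule linear_euclidean_expand) fact
    have "T (?y z) = Y p" "T (?z z) = Z p"
      using transition_diff_vf_coord[OF c p(1)] by (simp_all add: T_def p)
    then have "g p (Y p) (Z p) = g p (\<Sum>a\<in>Basis. (?y z \<bullet> a) *\<^sub>R T a) (\<Sum>b\<in>Basis. (?z z \<bullet> b) *\<^sub>R T b)"
      using T by metis
    also have "\<dots> = (\<Sum>a\<in>Basis. \<Sum>b\<in>Basis. (?y z \<bullet> a) *\<^sub>R (?z z \<bullet> b) *\<^sub>R g p (T a) (T b))"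
      by (simp only: metric_sum_left bilinear_lmul[OF bilinear_metric])
        (simp only: metric_sum_right bilinear_rmul[OF bilinear_metric] scaleR_sum_right)
    finally show ?thesis by (simp add: G_def p_def T_def Let_def)
  qed
  moreover have "smooth_on (chart_image c)
      (\<lambda>z. \<Sum>a\<in>Basis. \<Sum>b\<in>Basis. (?y z \<bullet> a) *\<^sub>R (?z z \<bullet> b) *\<^sub>R G a b z)"
    by (intro smooth_on_sum smooth_on_scaleR open_chart_image c G smooth_vf_D assms
        smooth_on_bounded_linear_compose[OF bounded_linear_inner_left])
  ultimately show "smooth_on (chart_image c) ((\<lambda>p. g p (Y p) (Z p)) \<circ> chart_inv c)"
    by (rule smooth_on_congI[OF open_chart_image[OF c]])
qed

text \<open>The two terms in which each of \<open>U\<close> and \<open>W\<close> is differentiated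
  once are together symmetric in \<open>X\<close> and \<open>Y\<close>, so they drop out of the
  commutator.\<close>

lemma dir_deriv_dir_deriv_metric:
  assumes "smooth_vf A X" "smooth_vf A Y" "smooth_vf A U" "smooth_vf A W"
  shows "dir_deriv A X (dir_deriv A Y (\<lambda>p. g p (U p) (W p))) p =
    g p (nabla X (nabla Y U) p) (W p) + g p (nabla Y U p) (nabla X W p)
    + (g p (nabla X U p) (nabla Y W p) + g p (U p) (nabla X (nabla Y W) p))"
  using assms
  by (simp add: dir_deriv_metric dir_deriv_add smooth_fun_metric smooth_vf_nabla)

section \<open>The curvature and its covariant derivatives as skew tensors\<close>

lemma smooth_vf_curvature:
  assumes "smooth_vf A X" "smooth_vf A Y" "smooth_vf A Z"
  shows "smooth_vf A (curvature A nabla X Y Z)"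
  unfolding curvature_def
  by (intro smooth_vf_diff smooth_vf_nabla smooth_vf_lie_bracket assms)

lemma curvature_skew:
  assumes "smooth_vf A X" "smooth_vf A Y" "smooth_vf A U" "smooth_vf A W"
  shows "g p (curvature A nabla X Y U p) (W p) + g p (U p) (curvature A nabla X Y W p) = 0"
proof -
  let ?f = "\<lambda>p. g p (U p) (W p)"
  have "dir_deriv A (lie_bracket A X Y) ?f p
      = g p (nabla (lie_bracket A X Y) U p) (W p) + g p (U p) (nabla (lie_bracket A X Y) W p)"
    using assms by (simp add: dir_deriv_metric smooth_vf_lie_bracket)
  then show ?thesis
    using dir_deriv_commutator[OF smooth_fun_metric[OF assms(3,4)] assms(1,2), of p]
    by (simp add: dir_deriv_dir_deriv_metric assms curvature_def metric_simps)
qed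

text \<open>The index 2 is the position of the argument the curvature operator acts on.\<close>

definition skew_tensor :: "nat \<Rightarrow> (('m, 'n) vfield list \<Rightarrow> ('m, 'n) vfield) \<Rightarrow> bool" where
  "skew_tensor n T \<longleftrightarrow>
    (\<forall>Vs. length Vs = n \<longrightarrow> (\<forall>V\<in>set Vs. smooth_vf A V) \<longrightarrow> smooth_vf A (T Vs)) \<and>
    (\<forall>Vs W p. length Vs = n \<longrightarrow> (\<forall>V\<in>set Vs. smooth_vf A V) \<longrightarrow> smooth_vf A W \<longrightarrow>
      g p (T Vs p) (W p) + g p ((Vs ! 2) p) (T (Vs[2 := W]) p) = 0)"

lemma skew_tensor_smooth:
  "skew_tensor n T \<Longrightarrow> length Vs = n \<Longrightarrow> (\<forall>V\<in>set Vs. smooth_vf A V) \<Longrightarrow> smooth_vf A (T Vs)"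
  by (simp add: skew_tensor_def)

lemma skew_tensor_skew:
  "skew_tensor n T \<Longrightarrow> length Vs = n \<Longrightarrow> (\<forall>V\<in>set Vs. smooth_vf A V) \<Longrightarrow> smooth_vf A W \<Longrightarrow>
    g p (T Vs p) (W p) + g p ((Vs ! 2) p) (T (Vs[2 := W]) p) = 0"
  by (simp add: skew_tensor_def)

lemma smooth_list_update:
  "\<forall>V\<in>set Vs. smooth_vf A V \<Longrightarrow> smooth_vf A W \<Longrightarrow> \<forall>V\<in>set (Vs[i := W]). smooth_vf A V"
  using set_update_subset_insert[of Vs i W] by blast

lemma covariant_deriv_snoc:
  "covariant_deriv nabla T (Us @ [Z]) p
    = nabla Z (T Us) p - (\<Sum>i<length Us. T (Us[i := nabla Z (Us ! i)]) p)"
  by (simp add: covariant_deriv_def)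

text \<open>Differentiate the skewness identity of \<open>T\<close> along \<open>Z\<close>. Metric
  compatibility yields the wanted covariant derivatives together with two terms that differentiate
  \<open>Us ! 2\<close> and \<open>W\<close>; the corrections at position 2 cancel these, and the
  other corrections cancel among themselves.\<close>

lemma covariant_deriv_skew:
  assumes T: "skew_tensor n T" and "2 < n" and len: "length Us = n"
    and Us: "\<forall>V\<in>set Us. smooth_vf A V" and Z: "smooth_vf A Z" and W: "smooth_vf A W"
  shows "g p (covariant_deriv nabla T (Us @ [Z]) p) (W p)
    + g p ((Us ! 2) p) (covariant_deriv nabla T (Us[2 := W] @ [Z]) p) = 0"
proof -
  let ?U = "Us ! 2" and ?Us' = "Us[2 := W]"
  \<comment> \<open>\<open>?h i\<close> collects the correction terms at position \<open>i\<close>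
    from both covariant derivatives.\<close>
  let ?h = "\<lambda>i. g p (T (Us[i := nabla Z (Us ! i)]) p) (W p)
    + g p (?U p) (T (?Us'[i := nabla Z (?Us' ! i)]) p)"
  have U: "smooth_vf A ?U" using Us len \<open>2 < n\<close> by simp
  have Us': "\<forall>V\<in>set ?Us'. smooth_vf A V" by (rule smooth_list_update[OF Us W])
  have TUs: "smooth_vf A (T Us)" by (rule skew_tensor_smooth[OF T len Us])
  have TUs': "smooth_vf A (T ?Us')" by (rule skew_tensor_smooth[OF T _ Us']) (simp add: len)
  \<comment> \<open>Only the term that differentiates the argument at position 2 survives.\<close>
  have "?h i = 0" if "i < n" "i \<noteq> 2" for i
  proof -
    have "smooth_vf A (nabla Z (Us ! i))" using Us len that Z by (simp add: smooth_vf_nabla)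
    then have "\<forall>V\<in>set (Us[i := nabla Z (Us ! i)]). smooth_vf A V"
      by (rule smooth_list_update[OF Us])
    from skew_tensor_skew[OF T _ this W, of p] show ?thesis
      using that len by (simp add: list_update_swap[of i 2])
  qed
  then have "(\<Sum>i<n. ?h i) = ?h 2"
    using \<open>2 < n\<close> by (subst sum.remove[of _ 2]) auto
  \<comment> \<open>Skewness of \<open>T\<close> is used for two pairs of arguments in position 2:
    the derivative of \<open>?U\<close> with \<open>W\<close>, and \<open>?U\<close> with the
    derivative of \<open>W\<close>.\<close>
  also have "\<dots> = - g p (nabla Z ?U p) (T ?Us' p) - g p (T Us p) (nabla Z W p)"
  proof -
    have "g p (T (Us[2 := nabla Z ?U]) p) (W p) + g p (nabla Z ?U p) (T ?Us' p) = 0"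
      using skew_tensor_skew[OF T _ smooth_list_update[OF Us smooth_vf_nabla[OF Z U]] W, of 2 p] len \<open>2 < n\<close>
      by simp
    moreover have "g p (T Us p) (nabla Z W p) + g p (?U p) (T (Us[2 := nabla Z W]) p) = 0"
      by (rule skew_tensor_skew[OF T len Us smooth_vf_nabla[OF Z W]])
    ultimately show ?thesis using len \<open>2 < n\<close> by simp
  qed
  finally have rest: "(\<Sum>i<n. ?h i)
    = - g p (nabla Z ?U p) (T ?Us' p) - g p (T Us p) (nabla Z W p)" .
  \<comment> \<open>The differentiated function is identically zero by skewness of
    \<open>T\<close>.\<close>
  have "dir_deriv A Z (\<lambda>p. g p (T Us p) (W p) + g p (?U p) (T ?Us' p)) p = 0"
    using skew_tensor_skew[OF T len Us W] by (simp add: dir_deriv_const)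
  then have "g p (nabla Z (T Us) p) (W p) + g p (T Us p) (nabla Z W p)
      + (g p (nabla Z ?U p) (T ?Us' p) + g p (?U p) (nabla Z (T ?Us') p)) = 0"
    by (simp add: dir_deriv_add smooth_fun_metric dir_deriv_metric TUs TUs' U W Z)
  then show ?thesis
    using rest by (simp add: covariant_deriv_snoc len metric_simps metric_sum_left metric_sum_right
        sum.distrib)
qed

text \<open>The bound \<open>2 < n\<close> keeps position 2 among the arguments of \<open>T\<close>,
  so replacing it by \<open>W\<close> never touches the direction of differentiation appended at the
  end.\<close>

lemma skew_tensor_covariant_deriv:
  assumes T: "skew_tensor n T" and "2 < n"
  shows "skew_tensor (Suc n) (covariant_deriv nabla T)"
  unfolding skew_tensor_def
proof (intro conjI allI impI)
  fix Vs :: "('m, 'n) vfield list"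
  assume len: "length Vs = Suc n" and Vs: "\<forall>V\<in>set Vs. smooth_vf A V"
  then obtain Us Z where Vs_eq: "Vs = Us @ [Z]" and Us_len: "length Us = n"
    by (metis length_Suc_conv_rev)
  have Us: "\<forall>V\<in>set Us. smooth_vf A V" and Z: "smooth_vf A Z"
    using Vs by (auto simp: Vs_eq)
  have "smooth_vf A (\<lambda>p. nabla Z (T Us) p - (\<Sum>i<length Us. T (Us[i := nabla Z (Us ! i)]) p))"
    using Us_len Us Z
    by (intro smooth_vf_diff smooth_vf_sum smooth_vf_nabla skew_tensor_smooth[OF T]
        smooth_list_update) auto
  then show "smooth_vf A (covariant_deriv nabla T Vs)"
    by (simp add: Vs_eq flip: covariant_deriv_snoc)
  fix W p assume "smooth_vf A W"
  from covariant_deriv_skew[OF T \<open>2 < n\<close> Us_len Us Z this, of p]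
  show "g p (covariant_deriv nabla T Vs p) (W p)
      + g p ((Vs ! 2) p) (covariant_deriv nabla T (Vs[2 := W]) p) = 0"
    using Us_len \<open>2 < n\<close> by (simp add: Vs_eq nth_append list_update_append)
qed

lemma skew_tensor_nabla_curvature: "skew_tensor (j + 3) (nabla_curvature A nabla j)"
proof (induction j)
  case 0
  have "smooth_vf A (Vs ! i)" if "length Vs = 3" "i < 3" "\<forall>V\<in>set Vs. smooth_vf A V" for Vs i
    using that by simp
  then show ?case
    by (auto simp: skew_tensor_def nabla_curvature_def smooth_vf_curvature curvature_skew)
next
  case (Suc j)
  have "nabla_curvature A nabla (Suc j) = covariant_deriv nabla (nabla_curvature A nabla j)"
    by (simp add: nabla_curvature_def)
  then show ?case using skew_tensor_covariant_deriv[OF Suc] by simp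
qed

text \<open>Replacing entry 2 of the list of extensions by the extension of \<open>w\<close> gives
  exactly the list that defines \<open>curv_endo\<close> at \<open>w\<close>. The identity for
  fields is then read at \<open>x\<close>, where the extensions of \<open>u\<close> and
  \<open>w\<close> take these values.\<close>

lemma curv_endo_skew:
  "g x (curv_endo A nabla x v1 v2 vs u) w + g x u (curv_endo A nabla x v1 v2 vs w) = 0"
proof -
  have "\<forall>V\<in>set (map (extend_vf A x) (v1 # v2 # u # vs)). smooth_vf A V"
    using extend_vf by auto
  from skew_tensor_skew[OF skew_tensor_nabla_curvature _ this extend_vf(1)[of x w],
      of "length vs" x]
  show ?thesis by (simp add: curv_endo_def extend_vf)
qed

text \<open>The skew endomorphisms form a Lie subalgebra containing every generator, whatever the
  order of differentiation, so by minimality they contain the generated algebra for each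
  \<open>k\<close>.\<close>

lemma dim_curv_lie_algebra_le:
  "2 * dim (curv_lie_algebra A nabla x k) + CARD('n) \<le> CARD('n) * CARD('n)"
proof -
  have "curv_lie_algebra A nabla x k \<subseteq> skew_endomorphisms (g x)"
    unfolding curv_lie_algebra_def
    by (intro hull_minimal lie_subalgebra_skew_endomorphisms bilinear_metric)
      (auto intro!: matrix_mem_skew_endomorphisms bilinear_metric curv_endo_skew)
  moreover have "2 * dim (skew_endomorphisms (g x)) + CARD('n) \<le> CARD('n) * CARD('n)"
    by (rule dim_skew_endomorphisms_le[OF bilinear_metric metric_sym])
      (rule metric_nondegenerate[of x])
  ultimately show ?thesis
    using dim_subset[of "curv_lie_algebra A nabla x k" "skew_endomorphisms (g x)"] by linarith
qed

end

theorem proposition4p3: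
  fixes A :: "('m::{t2_space, second_countable_topology}, 'n::finite) chart set"
    and nabla :: "('m, 'n) vfield \<Rightarrow> ('m, 'n) vfield \<Rightarrow> ('m, 'n) vfield"
    and x :: 'm and k :: nat
  assumes "analytic_atlas A"
    and "analytic_connection A nabla"
    and "real (dim (curv_lie_algebra A nabla x k)) > ((real CARD('n))\<^sup>2 - real CARD('n)) / 2"
  shows "\<not> (\<exists>g. pseudo_riemannian_metric A g \<and> levi_civita A g nabla)"
proof
  assume "\<exists>g. pseudo_riemannian_metric A g \<and> levi_civita A g nabla"
  then obtain g where "levi_civita_manifold A g nabla"
    using assms(1) by (auto simp: levi_civita_manifold_def levi_civita_manifold_axioms_def
        analytic_manifold_def)
  from levi_civita_manifold.dim_curv_lie_algebra_le[OF this, of x k]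
  have "2 * real (dim (curv_lie_algebra A nabla x k)) + real CARD('n) \<le> real CARD('n) * real CARD('n)"
    by (metis (mono_tags) of_nat_add of_nat_le_iff of_nat_mult of_nat_numeral)
  then show False using assms(3) by (simp add: power2_eq_square)
qed

end
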